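(* For every $\tau\in[0,1]$ the function $\varphi_\tau(s)=(1-\tau)f_0(s)+\tau f_1(s)$ satisfies the functional equation $$\varphi_\tau(s)=W(s)\,\overline{\varphi_\tau(1-\bar s)},\qquad W(s)=5^{(1/2)-s}\,2(2\pi)^{s-1}\,\Gamma(1-s)\sin\frac{\pi s}{2},$$ as an identity of meromorphic functions on $\mathbb{C}$. Moreover, as $\tau$ varies from $0$ to $1$, $\varphi_\tau$ is a continuous deformation of $f_0$ into $f_1$, i.e. $\varphi_0=f_0$, $\varphi_1=f_1$, and for every compact set $K\subset\mathbb{C}\setminus\{1\}$ and every $\tau'\in[0,1]$ one has $\lim_{\tau\to\tau'}\varphi_\tau(s)=\varphi_{\tau'}(s)$ uniformly for $s\in K$.
   Context: $\zeta$ denotes the Riemann zeta function. The function $f_0$ is $f_0(s)=\left(1+\frac{\sqrt5}{5^s}\right)\zeta(s)$, meromorphic on $\mathbb{C}$ with its only pole at $s=1$; for $\operatorname{Re}s>1$ it is the sum of the Dirichlet series $1+\frac1{2^s}+\frac1{3^s}+\frac1{4^s}+\frac{1+\sqrt5}{5^s}+\cdots$ with coefficients periodic modulo $5$. The function $f_1$ is the analytic continuation to the whole complex plane of the Dirichlet series $1-\frac1{2^s}-\frac1{3^s}+\frac1{4^s}+\frac0{5^s}+\cdots$ whose coefficients are periodic modulo $5$ (the Dirichlet $L$-function of the real even primitive character modulo $5$). *)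

theory Defs
  imports "HOL-Complex_Analysis.Complex_Analysis"
begin

text \<open>
  The analytic continuation to \<open>UNIV - P\<close> of the Dirichlet series with coefficients \<open>a 1, a 2, \<dots>\<close>
  (\<open>a 0\<close> is irrelevant). It is intended for bounded \<open>a\<close>, where the series converges for \<open>Re s > 1\<close>,
  and for finite \<open>P \<subseteq> {s. Re s \<le> 1}\<close>, where the continuation is unique if it exists.
  The value \<open>0\<close> on \<open>P\<close> only serves to make the function total; it follows the library's convention
  for the value at a pole.
\<close>

definition is_dirichlet_continuation ::
    "(nat \<Rightarrow> complex) \<Rightarrow> complex set \<Rightarrow> (complex \<Rightarrow> complex) \<Rightarrow> bool" where
  "is_dirichlet_continuation a P F \<longleftrightarrow>
     F holomorphic_on (UNIV - P) \<and>
     (\<forall>s. Re s > 1 \<longrightarrow> (\<lambda>n. a (Suc n) / of_nat (Suc n) powr s) sums F s) \<and>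
     (\<forall>s\<in>P. F s = 0)"

definition dirichlet_continuation ::
    "(nat \<Rightarrow> complex) \<Rightarrow> complex set \<Rightarrow> complex \<Rightarrow> complex" where
  "dirichlet_continuation a P = (THE F. is_dirichlet_continuation a P F)"

lemma is_dirichlet_continuation_unique:
  assumes P: "finite P" "\<And>s. s \<in> P \<Longrightarrow> Re s \<le> 1"
    and F: "is_dirichlet_continuation a P F" and G: "is_dirichlet_continuation a P G"
  shows "F = G"
proof
  fix z
  have eq: "F s = G s" if "s \<in> {s. Re s > 1}" for s
    using that F G unfolding is_dirichlet_continuation_def by (blast intro: sums_unique2)
  show "F z = G z"
  proof (cases "z \<in> P")
    case True
    then show ?thesis
      using F G by (simp add: is_dirichlet_continuation_def)
  next
    case False
    show ?thesis
    proof (rule analytic_continuation_open[where f = F and g = G and s = "{s. Re s > 1}" and s' = "UNIV - P"])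
      show "open {s. Re s > 1}"
        by (rule open_halfspace_Re_gt)
      show "open (UNIV - P)"
        using P(1) by (simp add: open_Diff finite_imp_closed)
      have "2 \<in> {s. Re s > 1}"
        by simp
      then show "{s. Re s > 1} \<noteq> {}"
        by blast
      show "connected (UNIV - P)"
        using P(1) by (intro connected_open_delete_finite) auto
      show "{s. Re s > 1} \<subseteq> UNIV - P"
        using P(2) by force
    qed (use F G eq False in \<open>auto simp: is_dirichlet_continuation_def\<close>)
  qed
qed

lemma dirichlet_continuation_eqI:
  assumes "finite P" "\<And>s. s \<in> P \<Longrightarrow> Re s \<le> 1" "is_dirichlet_continuation a P F"
  shows "dirichlet_continuation a P = F"
  unfolding dirichlet_continuation_def
  using assms is_dirichlet_continuation_unique by blast

definition riemann_zeta :: "complex \<Rightarrow> complex" where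
  "riemann_zeta = dirichlet_continuation (\<lambda>_. 1) {1}"

definition chi5 :: "nat \<Rightarrow> complex" where
  "chi5 n = (if n mod 5 = 0 then 0 else if n mod 5 = 1 \<or> n mod 5 = 4 then 1 else -1)"

definition f0 :: "complex \<Rightarrow> complex" where
  "f0 s = (1 + of_real (sqrt 5) / 5 powr s) * riemann_zeta s"

definition f1 :: "complex \<Rightarrow> complex" where
  "f1 = dirichlet_continuation chi5 {}"

definition phi :: "real \<Rightarrow> complex \<Rightarrow> complex" where
  "phi \<tau> s = of_real (1 - \<tau>) * f0 s + of_real \<tau> * f1 s"

text \<open>
  The library's \<open>Gamma\<close> takes the value \<open>0\<close> at its poles, so the values of \<open>W\<close> at positive
  integers carry no meaning (in particular at even ones, where the singularity is removable).
\<close>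

definition W :: "complex \<Rightarrow> complex" where
  "W s = 5 powr (1/2 - s) * 2 * (2 * of_real pi) powr (s - 1) * Gamma (1 - s) *
         sin (of_real pi * s / 2)"

end

theory Submission
  imports Defs
begin

text \<open>
  \<open>\<zeta>\<close> and the \<open>L\<close>-function have even periodic coefficients \<open>a\<close> that are an eigenvector of the finite
  Fourier transform modulo \<open>N\<close> with eigenvalue \<open>\<surd>N\<close> (\<open>N = 1\<close> and \<open>N = 5\<close>). For such \<open>a\<close>, the
  partial fraction expansion of the cotangent gives, for \<open>x > 0\<close>,
  \<open>\<Sum> a(n) exp(-n x) = a(0)/(\<surd>N x) - a(0)/2 + 1/\<surd>N \<Sum> a(n) 2x/(x^2 + (2\<pi>n/N)^2)\<close>.
  The Mellin transform of the left side is \<open>\<Gamma>(s) L(s)\<close> for \<open>Re s > 1\<close>. Splitting that integral at \<open>1\<close>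
  and moving the two elementary terms continues it to \<open>Re s > -1\<close>; for \<open>-1 < Re s < 0\<close> the result is the
  Mellin transform of the last series, which is a multiple of \<open>L(1 - s)\<close>. So the functional equation
  holds on this strip, and it serves as the definition of the continuation to the left of it.

  For \<open>f0\<close>, multiplying \<open>\<zeta>(1 - s)\<close> by \<open>5^(1/2 - s) (1 + \<surd>5 / 5^(1 - s)) = 1 + \<surd>5 / 5^s\<close> turns the
  functional equation of \<open>\<zeta>\<close> into the one with conductor \<open>5\<close>.
\<close>

subsection \<open>Mellin transforms\<close>

definition has_mellin :: "(real \<Rightarrow> complex) \<Rightarrow> complex \<Rightarrow> complex \<Rightarrow> bool" where
  "has_mellin f s v \<longleftrightarrow>
     has_bochner_integral lborel (\<lambda>x. indicator {0<..} x *\<^sub>R (of_real x powr (s - 1) * f x)) v"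

lemma norm_of_real_powr: "x > 0 \<Longrightarrow> norm (complex_of_real x powr s) = x powr Re s"
  by (simp add: norm_powr_real_powr)

text \<open>
  The integrand is expanded in powers of \<open>(s - s0) ln x\<close>; on \<open>ball s0 r\<close> all partial sums are dominated
  by \<open>(x^r + x^(-r)) |x^(s0 - 1) f x|\<close>.
\<close>

lemma holomorphic_on_powr_integral:
  fixes f :: "real \<Rightarrow> complex"
  assumes A: "open A" and S: "S \<subseteq> {0<..}"
    and int: "\<And>s. s \<in> A \<Longrightarrow> set_integrable lborel S (\<lambda>x. of_real x powr (s - 1) * f x)"
  shows "(\<lambda>s. LINT x:S|lborel. of_real x powr (s - 1) * f x) holomorphic_on A"
proof -
  define I where "I = (\<lambda>s. LINT x:S|lborel. of_real x powr (s - 1) * f x)"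
  have "\<exists>r>0. I holomorphic_on ball s0 r" if s0: "s0 \<in> A" for s0
  proof -
    obtain r0 where r0: "r0 > 0" "ball s0 r0 \<subseteq> A"
      using A s0 open_contains_ball by blast
    define r where "r = r0 / 2"
    have r: "r > 0" using r0 by (simp add: r_def)
    have mem: "s0 + of_real t \<in> A" if "\<bar>t\<bar> \<le> r" for t
      using that r0 by (intro subsetD[OF r0(2)]) (auto simp: r_def dist_norm)
    define g where "g = (\<lambda>s x. indicator S x *\<^sub>R (complex_of_real x powr (s - 1) * f x))"
    have gint: "integrable lborel (g s)" if "s \<in> A" for s
      using int[OF that] by (simp add: set_integrable_def g_def)
    define c where "c = (\<lambda>k. LINT x|lborel. of_real (ln x ^ k / fact k) * g s0 x)"
    define w where "w = (\<lambda>x. norm (g (s0 + of_real r) x) + norm (g (s0 + of_real (-r)) x))"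
    have w_int: "integrable lborel w"
      unfolding w_def using mem[of r] mem[of "-r"] r by (auto intro!: gint)
    have meas: "g s \<in> borel_measurable lborel" if "s \<in> A" for s
      using gint[OF that] by auto
    have exp_le: "exp (\<bar>u\<bar> * \<bar>ln x\<bar>) * norm (g s0 x) \<le> w x" if "\<bar>u\<bar> \<le> r" for u x
    proof (cases "x \<in> S")
      case True
      then have x: "x > 0" using S by auto
      have "exp (\<bar>u\<bar> * \<bar>ln x\<bar>) \<le> x powr r + x powr (-r)"
      proof (cases "ln x \<ge> 0")
        case True
        then have "exp (\<bar>u\<bar> * \<bar>ln x\<bar>) \<le> exp (r * ln x)"
          using that by (auto intro!: mult_right_mono)
        then show ?thesis using x by (simp add: powr_def add_increasing2)
      next
        case False
        then have "exp (\<bar>u\<bar> * \<bar>ln x\<bar>) \<le> exp (- r * ln x)"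
          using that by (auto intro!: mult_right_mono simp: abs_if mult_less_0_iff)
        then show ?thesis using x by (simp add: powr_def add_increasing)
      qed
      moreover have "norm (g (s0 + of_real t) x) = x powr t * norm (g s0 x)" for t
        using True x by (simp add: g_def norm_mult norm_of_real_powr powr_add [symmetric] algebra_simps)
      ultimately show ?thesis
        using mult_right_mono[of "exp (\<bar>u\<bar> * \<bar>ln x\<bar>)" "x powr r + x powr (-r)" "norm (g s0 x)"]
          \<open>\<And>t. norm (g (s0 + of_real t) x) = x powr t * norm (g s0 x)\<close>[of r]
          \<open>\<And>t. norm (g (s0 + of_real t) x) = x powr t * norm (g s0 x)\<close>[of "-r"]
        by (simp only: w_def) (simp add: algebra_simps)
    next
      case False
      then show ?thesis by (simp add: g_def w_def)
    qed
    have sums: "(\<lambda>k. c k * (z - s0) ^ k) sums I z" if z: "z \<in> ball s0 r" for z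
    proof -
      define u where "u = z - s0"
      have u: "norm u \<le> r" using z by (auto simp: u_def dist_norm norm_minus_commute)
      define t where "t = (\<lambda>k x. (u * of_real (ln x)) ^ k / fact k * g s0 x)"
      have zA: "z \<in> A" using z r0(2) r by (auto simp: r_def)
      have bd: "norm (\<Sum>k<n. t k x) \<le> w x" for n x
      proof -
        have "norm (\<Sum>k<n. t k x) \<le> (\<Sum>k<n. (norm u * \<bar>ln x\<bar>) ^ k / fact k) * norm (g s0 x)"
          unfolding sum_distrib_right
          by (rule order_trans[OF norm_sum])
             (simp add: t_def norm_mult norm_power norm_divide power_mult_distrib)
        also have "(\<Sum>k<n. (norm u * \<bar>ln x\<bar>) ^ k / fact k) \<le> exp (norm u * \<bar>ln x\<bar>)"
        proof -
          have "(\<lambda>k. (norm u * \<bar>ln x\<bar>) ^ k / fact k) sums exp (norm u * \<bar>ln x\<bar>)"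
            using exp_converges[of "norm u * \<bar>ln x\<bar>"] by (simp add: field_simps)
          then show ?thesis
            using sum_le_suminf[of "\<lambda>k. (norm u * \<bar>ln x\<bar>) ^ k / fact k" "{..<n}"] by (simp add: sums_iff)
        qed
        also have "exp (norm u * \<bar>ln x\<bar>) * norm (g s0 x) \<le> w x"
          using exp_le[of "norm u"] u by simp
        finally show ?thesis by (simp add: mult_right_mono)
      qed
      have lim: "(\<lambda>n. \<Sum>k<n. t k x) \<longlonglongrightarrow> g z x" for x
      proof (cases "x \<in> S")
        case True
        then have x: "x > 0" using S by auto
        have "(\<lambda>k. (u * of_real (ln x)) ^ k / fact k * g s0 x) sums (exp (u * of_real (ln x)) * g s0 x)"
          using exp_converges[of "u * complex_of_real (ln x)"]
          by (intro sums_mult2) (simp add: scaleR_conv_of_real field_simps)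
        moreover have "exp (u * of_real (ln x)) * g s0 x = g z x"
          using x True by (simp add: g_def u_def powr_def Ln_of_real exp_add [symmetric] algebra_simps)
        ultimately show ?thesis by (simp add: sums_def t_def)
      qed (simp add: g_def t_def)
      have tm: "t k \<in> borel_measurable lborel" for k
        unfolding t_def using meas[OF s0] by measurable
      have tint: "integrable lborel (t k)" for k
      proof (rule Bochner_Integration.integrable_bound)
        show "integrable lborel (\<lambda>x. 2 * w x)" using w_int by simp
        show "AE x in lborel. norm (t k x) \<le> norm (2 * w x)"
        proof (rule AE_I2)
          fix x
          have "t k x = (\<Sum>j<Suc k. t j x) - (\<Sum>j<k. t j x)" by simp
          then have "norm (t k x) \<le> norm (\<Sum>j<Suc k. t j x) + norm (\<Sum>j<k. t j x)"
            by (metis norm_triangle_ineq4)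
          also have "\<dots> \<le> 2 * w x" using bd[of x k] bd[of x "Suc k"] by linarith
          finally show "norm (t k x) \<le> norm (2 * w x)" by simp
        qed
      qed (rule tm)
      have "(\<lambda>n. LINT x|lborel. (\<Sum>k<n. t k x)) \<longlonglongrightarrow> (LINT x|lborel. g z x)"
        by (rule integral_dominated_convergence[where w = w])
           (use w_int lim bd tm meas[OF zA] in auto)
      moreover have "(LINT x|lborel. (\<Sum>k<n. t k x)) = (\<Sum>k<n. c k * u ^ k)" for n
      proof -
        have "(LINT x|lborel. t k x) = c k * u ^ k" for k
        proof -
          have "t k = (\<lambda>x. u ^ k * (of_real (ln x ^ k / fact k) * g s0 x))"
            by (auto simp: t_def power_mult_distrib field_simps)
          then show ?thesis by (simp add: c_def)
        qed
        then show ?thesis using tint by (simp add: Bochner_Integration.integral_sum)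
      qed
      ultimately show ?thesis
        by (simp add: sums_def u_def I_def g_def set_lebesgue_integral_def)
    qed
    have "I holomorphic_on ball s0 r"
      by (rule power_series_holomorphic[where a = c]) (use sums in auto)
    with r show ?thesis by blast
  qed
  then have "I analytic_on A"
    by (simp add: analytic_on_def)
  then show ?thesis unfolding I_def by (rule analytic_imp_holomorphic)
qed

lemma has_mellin_iff:
  "has_mellin f s v \<longleftrightarrow> set_integrable lborel {0<..} (\<lambda>x. of_real x powr (s - 1) * f x) \<and>
     (LINT x:{0<..}|lborel. of_real x powr (s - 1) * f x) = v"
  by (simp add: has_mellin_def has_bochner_integral_iff set_integrable_def set_lebesgue_integral_def)

lemma has_mellin_scale:
  assumes "has_mellin g s v" "l > 0"
  shows "has_mellin (\<lambda>x. g (l * x)) s (of_real l powr (-s) * v)"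
proof -
  have "has_bochner_integral lborel (\<lambda>x. indicator {0<..} (0 + l * x) *\<^sub>R (of_real (0 + l * x) powr (s - 1) * g (0 + l * x))) (v /\<^sub>R \<bar>l\<bar>)"
    using assms lborel_has_bochner_integral_real_affine_iff[of l "\<lambda>x. indicator {0<..} x *\<^sub>R (of_real x powr (s - 1) * g x)" v 0]
    by (simp add: has_mellin_def)
  then have "has_bochner_integral lborel (\<lambda>x. of_real l powr (1 - s) * (indicator {0<..} (0 + l * x) *\<^sub>R (of_real (0 + l * x) powr (s - 1) * g (0 + l * x)))) (of_real l powr (1 - s) * (v /\<^sub>R \<bar>l\<bar>))"
    by (rule has_bochner_integral_mult_right)
  also have "(\<lambda>x. of_real l powr (1 - s) * (indicator {0<..} (0 + l * x) *\<^sub>R (of_real (0 + l * x) powr (s - 1) * g (0 + l * x))))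
     = (\<lambda>x. indicator {0<..} x *\<^sub>R (of_real x powr (s - 1) * g (l * x)))"
  proof
    fix x
    have "complex_of_real l powr (1 - s) * (of_real l powr (s - 1)) = 1"
      using \<open>l > 0\<close> by (simp add: powr_add [symmetric])
    then show "of_real l powr (1 - s) * (indicator {0<..} (0 + l * x) *\<^sub>R (of_real (0 + l * x) powr (s - 1) * g (0 + l * x)))
       = indicator {0<..} x *\<^sub>R (of_real x powr (s - 1) * g (l * x))"
      using \<open>l > 0\<close> by (auto simp: indicator_def zero_less_mult_iff powr_times_real)
  qed
  also have "of_real l powr (1 - s) * (v /\<^sub>R \<bar>l\<bar>) = of_real l powr (-s) * v"
    using \<open>l > 0\<close> by (simp add: powr_diff powr_minus scaleR_conv_of_real field_simps)
  finally show ?thesis by (simp add: has_mellin_def)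
qed

lemma has_mellin_norm:
  assumes "has_mellin g s v"
  shows "\<exists>w. has_mellin (\<lambda>x. of_real (norm (g x))) (of_real (Re s)) (of_real w)"
proof -
  let ?h = "\<lambda>x. norm (indicator {0<..} x *\<^sub>R (of_real x powr (s - 1) * g x))"
  have "integrable lborel ?h"
    using assms unfolding has_mellin_def has_bochner_integral_iff by (intro integrable_norm) blast
  then have "has_bochner_integral lborel (\<lambda>x. complex_of_real (?h x)) (of_real (integral\<^sup>L lborel ?h))"
    by (intro has_bochner_integral_of_real) (simp add: has_bochner_integral_iff)
  also have "(\<lambda>x. complex_of_real (?h x)) = (\<lambda>x. indicator {0<..} x *\<^sub>R (of_real x powr (of_real (Re s) - 1) * of_real (norm (g x))))"
  proof
    fix x
    have "complex_of_real x powr (complex_of_real (Re s) - 1) = of_real (x powr (Re s - 1))" if "x > 0"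
      using that powr_of_real[of x "Re s - 1"] by simp
    then show "complex_of_real (?h x) = indicator {0<..} x *\<^sub>R (of_real x powr (of_real (Re s) - 1) * of_real (norm (g x)))"
      by (auto simp: indicator_def norm_mult norm_of_real_powr)
  qed
  finally show ?thesis unfolding has_mellin_def by blast
qed

lemma has_mellin_suminf:
  fixes c :: "nat \<Rightarrow> complex" and l :: "nat \<Rightarrow> real"
  assumes g: "has_mellin g s v" and l: "\<And>n. l n > 0"
    and c: "summable (\<lambda>n. norm (c n) * l n powr (- Re s))"
    and abs_conv: "\<And>x. x > 0 \<Longrightarrow> summable (\<lambda>n. norm (c n * g (l n * x)))"
    and F: "\<And>x. x > 0 \<Longrightarrow> (\<lambda>n. c n * g (l n * x)) sums F x"
  shows "has_mellin F s ((\<Sum>n. c n * of_real (l n) powr (-s)) * v)"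
proof -
  define h where "h = (\<lambda>n x. indicator {0<..} x *\<^sub>R (of_real x powr (s - 1) * (c n * g (l n * x))))"
  have hn: "has_bochner_integral lborel (h n) (c n * (of_real (l n) powr (-s) * v))" for n
  proof -
    have "has_bochner_integral lborel (\<lambda>x. c n * (indicator {0<..} x *\<^sub>R (of_real x powr (s - 1) * g (l n * x))))
            (c n * (of_real (l n) powr (-s) * v))"
      using has_mellin_scale[OF g l[of n]] unfolding has_mellin_def
      by (rule has_bochner_integral_mult_right)
    then show ?thesis by (simp add: h_def mult_ac scaleR_conv_of_real)
  qed
  obtain w where w: "has_mellin (\<lambda>x. of_real (norm (g x))) (of_real (Re s)) (of_real w)"
    using has_mellin_norm[OF g] by blast
  have hnorm: "(LINT x|lborel. norm (h n x)) = norm (c n) * l n powr (- Re s) * w" for n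
  proof -
    have "has_bochner_integral lborel (\<lambda>x. complex_of_real (norm (c n)) * (indicator {0<..} x *\<^sub>R (of_real x powr (of_real (Re s) - 1) * of_real (norm (g (l n * x))))))
            (of_real (norm (c n)) * (of_real (l n) powr (- of_real (Re s)) * of_real w))"
      using has_mellin_scale[OF w l[of n]] unfolding has_mellin_def
      by (rule has_bochner_integral_mult_right)
    also have "(\<lambda>x. complex_of_real (norm (c n)) * (indicator {0<..} x *\<^sub>R (of_real x powr (of_real (Re s) - 1) * of_real (norm (g (l n * x)))))) = (\<lambda>x. complex_of_real (norm (h n x)))"
    proof
      fix x
      have "complex_of_real x powr (complex_of_real (Re s) - 1) = of_real (x powr (Re s - 1))" if "x > 0"
        using that powr_of_real[of x "Re s - 1"] by simp
      then show "of_real (norm (c n)) * (indicator {0<..} x *\<^sub>R (of_real x powr (of_real (Re s) - 1) * of_real (norm (g (l n * x))))) = complex_of_real (norm (h n x))"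
        by (auto simp: h_def indicator_def norm_mult norm_of_real_powr)
    qed
    also have "of_real (l n) powr (- of_real (Re s)) = complex_of_real (l n powr (- Re s))"
      using l[of n] powr_of_real[of "l n" "- Re s"] by simp
    finally have "has_bochner_integral lborel (\<lambda>x. complex_of_real (norm (h n x))) (of_real (norm (c n) * l n powr (- Re s) * w))"
      by (simp add: mult.assoc)
    from has_bochner_integral_integral_eq[OF this] show ?thesis
      unfolding integral_complex_of_real of_real_eq_iff .
  qed
  have hint: "integrable lborel (h n)" for n using hn[of n] by (auto simp: has_bochner_integral_iff)
  have hsum: "summable (\<lambda>n. norm (h n x))" for x
    using abs_conv[of x]
    by (cases "x > 0") (auto simp: h_def norm_mult[of "of_real x powr _"] summable_mult simp del: norm_mult)
  have s2: "summable (\<lambda>n. LINT x|lborel. norm (h n x))"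
    unfolding hnorm by (intro summable_mult2 c)
  have eq: "(\<Sum>n. h n x) = indicator {0<..} x *\<^sub>R (of_real x powr (s - 1) * F x)" for x
  proof (cases "x > 0")
    case True
    then show ?thesis
      using sums_mult[OF F[OF True], of "of_real x powr (s - 1)"] by (simp add: h_def sums_iff)
  qed (simp add: h_def)
  have "integrable lborel (\<lambda>x. \<Sum>n. h n x)"
    by (rule integrable_suminf) (use hint hsum s2 in auto)
  moreover have "(\<lambda>n. integral\<^sup>L lborel (h n)) sums (LINT x|lborel. (\<Sum>n. h n x))"
    by (rule sums_integral) (use hint hsum s2 in auto)
  moreover have "integral\<^sup>L lborel (h n) = c n * of_real (l n) powr (-s) * v" for n
    using hn[of n] by (simp add: has_bochner_integral_iff)
  moreover have "summable (\<lambda>n. c n * of_real (l n) powr (-s))"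
    by (rule summable_norm_cancel) (use c l in \<open>simp add: norm_mult norm_of_real_powr\<close>)
  ultimately show ?thesis
    unfolding has_mellin_def has_bochner_integral_iff eq by (simp add: sums_iff suminf_mult2)
qed

lemma set_integrable_powr_bound:
  fixes f :: "real \<Rightarrow> complex"
  assumes int: "set_integrable lborel S (\<lambda>x. of_real x powr (s' - 1) * f x)"
    and S: "S \<subseteq> {0<..}"
    and le: "\<And>x. x \<in> S \<Longrightarrow> x powr Re s \<le> x powr Re s'"
  shows "set_integrable lborel S (\<lambda>x. of_real x powr (s - 1) * f x)"
proof -
  let ?g = "\<lambda>s x. indicator S x *\<^sub>R (complex_of_real x powr (s - 1) * f x)"
  have g1: "integrable lborel (?g s')" using int by (simp add: set_integrable_def)
  have "integrable lborel (?g s)"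
  proof (rule Bochner_Integration.integrable_bound[OF g1])
    have "(\<lambda>x. of_real x powr (s - s') * ?g s' x) \<in> borel_measurable lborel"
      using borel_measurable_integrable[OF g1] by measurable
    also have "(\<lambda>x. of_real x powr (s - s') * ?g s' x) = ?g s"
      using S by (auto simp: fun_eq_iff indicator_def powr_add [symmetric] algebra_simps mult.assoc [symmetric])
    finally show "?g s \<in> borel_measurable lborel" .
    show "AE x in lborel. norm (?g s x) \<le> norm (?g s' x)"
    proof (rule AE_I2)
      fix x
      show "norm (?g s x) \<le> norm (?g s' x)"
      proof (cases "x \<in> S")
        case True
        then have "x > 0" using S by auto
        have "x powr (Re s - 1) \<le> x powr (Re s' - 1)"
          using le[OF True] \<open>x > 0\<close> by (simp add: powr_diff divide_right_mono)
        with True \<open>x > 0\<close> show ?thesis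
          by (simp add: norm_mult norm_of_real_powr mult_right_mono)
      qed simp
    qed
  qed
  then show ?thesis by (simp add: set_integrable_def)
qed

lemma has_mellin_absI:
  assumes abs: "(\<lambda>x. complex_of_real x powr (s - 1) * f x) absolutely_integrable_on {0<..}"
    and v: "integral {0<..} (\<lambda>x. complex_of_real x powr (s - 1) * f x) = v"
    and f: "f \<in> borel_measurable borel"
  shows "has_mellin f s v"
proof -
  have [measurable]: "f \<in> borel_measurable borel" by fact
  have m: "(\<lambda>x. indicator {0<..} x *\<^sub>R (complex_of_real x powr (s - 1) * f x)) \<in> borel_measurable lborel"
    by measurable
  show ?thesis
    using abs v set_lebesgue_integral_eq_integral(2)[OF abs] integrable_completion[OF m] integral_completion[OF m]
    by (simp add: has_mellin_def has_bochner_integral_iff set_integrable_def set_lebesgue_integral_def)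
qed

lemma has_mellin_exp:
  assumes "Re s > 0"
  shows "has_mellin (\<lambda>x. of_real (exp (-x))) s (Gamma s)"
proof (rule has_mellin_absI)
  have eq: "(\<lambda>x. complex_of_real x powr (s - 1) * of_real (exp (-x))) = (\<lambda>t. complex_of_real t powr (s - 1) / of_real (exp t))"
    by (simp add: exp_minus field_simps)
  show "(\<lambda>x. complex_of_real x powr (s - 1) * of_real (exp (-x))) absolutely_integrable_on {0<..}"
    unfolding eq by (rule absolutely_integrable_Gamma_integral'[OF assms])
  show "integral {0<..} (\<lambda>x. complex_of_real x powr (s - 1) * of_real (exp (-x))) = Gamma s"
    unfolding eq by (rule integral_unique[OF Gamma_integral_complex'[OF assms]])
qed measurable

lemma beta_substitution:
  fixes t :: real
  assumes t: "-1 < t" "t < 1"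
  defines "p \<equiv> (t + 1) / 2"
  shows "(\<lambda>x. x powr (t - 1) * (2 * x / (x^2 + 1))) absolutely_integrable_on {0<..} \<and>
         integral {0<..} (\<lambda>x. x powr (t - 1) * (2 * x / (x^2 + 1))) = Beta p (1 - p)"
proof -
  have p: "p > 0" "1 - p > 0" using t by (auto simp: p_def)
  define f where "f = (\<lambda>y::real. y powr (p - 1) * (1 - y) powr (1 - p - 1))"
  define g where "g = (\<lambda>x::real. x^2 / (x^2 + 1))"
  define g' where "g' = (\<lambda>x::real. 2 * x / (x^2 + 1)^2)"
  have pos: "x^2 + 1 > 0" for x :: real by (simp add: add_nonneg_pos)
  have hi: "(f has_integral Beta p (1 - p)) {0<..<1}"
    using has_integral_Beta_real[OF p] by (simp add: f_def has_integral_Icc_iff_Ioo)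
  have "f absolutely_integrable_on {0<..<1}"
    by (rule nonnegative_absolutely_integrable_1[OF has_integral_integrable[OF hi]]) (simp add: f_def)
  then have fabs: "f absolutely_integrable_on {0<..<1} \<and> integral {0<..<1} f = Beta p (1 - p)"
    using integral_unique[OF hi] by blast
  have img: "g ` {0<..} = {0<..<1}"
  proof (intro equalityI subsetI)
    fix y assume "y \<in> g ` {0<..}"
    then show "y \<in> {0<..<1}" using pos by (auto simp: g_def divide_simps)
  next
    fix y :: real assume y: "y \<in> {0<..<1}"
    then have "g (sqrt (y / (1 - y))) = y" by (simp add: g_def field_simps)
    moreover have "sqrt (y / (1 - y)) > 0" using y by simp
    ultimately show "y \<in> g ` {0<..}" by (metis greaterThan_iff imageI)
  qed
  have inj: "inj_on g {0<..}"
  proof (rule inj_onI)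
    fix x y :: real assume xy: "x \<in> {0<..}" "y \<in> {0<..}" "g x = g y"
    then have "x^2 * (y^2 + 1) = y^2 * (x^2 + 1)" using pos[of x] pos[of y] by (simp add: g_def frac_eq_eq)
    then have "x^2 = y^2" by (simp add: algebra_simps)
    then show "x = y" using xy by (simp add: power2_eq_iff)
  qed
  have der: "(g has_field_derivative g' x) (at x within {0<..})" for x
    unfolding g_def g'_def using pos[of x]
    by (auto intro!: derivative_eq_intros simp: power2_eq_square algebra_simps divide_simps)
  have eq: "\<bar>g' x\<bar> * f (g x) = x powr (t - 1) * (2 * x / (x^2 + 1))" if "x \<in> {0<..}" for x
  proof -
    have x: "x > 0" using that by simp
    define q where "q = x^2 + 1"
    have q: "q > 0" "x^2 > 0" using pos x by (auto simp: q_def)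
    have "1 - x^2 / q = (q - x^2) / q" using q(1) by (simp add: diff_divide_distrib)
    then have "1 - g x = 1 / q" by (simp add: g_def q_def)
    then have "f (g x) = (x^2 / q) powr (p - 1) * (1 / q) powr (-p)"
      by (simp add: f_def g_def q_def)
    also have "\<dots> = (x^2) powr (p - 1) * (q powr (-(p - 1)) * q powr p)"
    proof -
      have "(x^2 / q) powr (p - 1) = (x^2) powr (p - 1) * q powr (-(p - 1))"
        using q powr_divide[of "x^2" q "p - 1"] unfolding powr_minus by (simp add: divide_inverse)
      moreover have "(1 / q) powr (-p) = q powr p"
        using q by (simp add: powr_divide powr_minus)
      ultimately show ?thesis by (simp only: mult.assoc)
    qed
    also have "q powr (-(p - 1)) * q powr p = q" using q by (simp add: powr_add [symmetric])
    also have "(x^2) powr (p - 1) = x powr (t - 1)"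
    proof -
      have "(x^2) powr (p - 1) = x powr (2 * (p - 1))" using x by (simp add: powr_powr flip: powr_numeral)
      also have "2 * (p - 1) = t - 1" by (simp add: p_def)
      finally show ?thesis .
    qed
    finally have fg: "f (g x) = x powr (t - 1) * q" .
    have "g' x = 2 * x / q^2" by (simp add: g'_def q_def)
    then have "\<bar>g' x\<bar> = 2 * x / q^2" using x by simp
    then have "\<bar>g' x\<bar> * f (g x) = x powr (t - 1) * (2 * x / q)"
      using q(1) by (simp add: fg power2_eq_square)
    then show ?thesis by (simp add: q_def)
  qed
  have "(\<lambda>x. \<bar>g' x\<bar> * f (g x)) absolutely_integrable_on {0<..} \<and>
        integral {0<..} (\<lambda>x. \<bar>g' x\<bar> * f (g x)) = Beta p (1 - p)"
    using has_absolute_integral_change_of_variables_1'[of "{0<..}" g g' f "Beta p (1 - p)"] der inj fabs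
    by (simp add: img)
  moreover have "(\<lambda>x. \<bar>g' x\<bar> * f (g x)) absolutely_integrable_on {0<..} \<longleftrightarrow>
      (\<lambda>x. x powr (t - 1) * (2 * x / (x^2 + 1))) absolutely_integrable_on {0<..}"
    by (rule set_integrable_cong) (use eq in auto)
  moreover have "integral {0<..} (\<lambda>x. \<bar>g' x\<bar> * f (g x)) = integral {0<..} (\<lambda>x. x powr (t - 1) * (2 * x / (x^2 + 1)))"
    by (rule integral_cong) (use eq in auto)
  ultimately show ?thesis by simp
qed

lemma Beta_reflection_half:
  fixes t :: real
  assumes t: "-1 < t" "t < 1"
  shows "complex_of_real (Beta ((t + 1) / 2) (1 - (t + 1) / 2)) = of_real pi / cos (of_real pi * of_real t / 2)"
proof -
  define p :: complex where "p = of_real ((t + 1) / 2)"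
  have "complex_of_real (Beta ((t + 1) / 2) (1 - (t + 1) / 2)) = Beta p (1 - p)"
    by (simp add: p_def Beta_complex_of_real [symmetric])
  also have "\<dots> = Gamma p * Gamma (1 - p)" by (simp add: Beta_altdef)
  also have "\<dots> = of_real pi / sin (of_real pi * p)" by (rule Gamma_reflection_complex)
  also have "of_real pi * p = of_real pi / 2 + of_real pi * of_real t / 2" by (simp add: p_def field_simps)
  also have "sin (of_real pi / 2 + of_real pi * of_real t / 2 :: complex) = cos (of_real pi * of_real t / 2)"
  proof -
    have "sin (complex_of_real pi / 2) = 1" "cos (complex_of_real pi / 2) = 0"
      using sin_of_real[of "pi / 2", where 'a = complex] cos_of_real[of "pi / 2", where 'a = complex] by simp_all
    then show ?thesis by (simp add: sin_add)
  qed
  finally show ?thesis .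
qed

lemma cos_half_pi_nonzero:
  assumes "-1 < Re s" "Re s < 1"
  shows "cos (of_real pi * s / 2) \<noteq> 0"
proof
  assume "cos (of_real pi * s / 2) = 0"
  then obtain n :: int where n: "of_real pi * s / 2 = of_real (of_int n * pi) + of_real pi / 2"
    by (auto simp: cos_eq_0)
  have "Re (of_real pi * s / 2) = of_int n * pi + pi / 2" unfolding n by simp
  then have "pi * Re s = pi * (2 * of_int n + 1)" by (simp add: algebra_simps)
  then have "Re s = of_int (2 * n + 1)" by simp
  with assms have "real_of_int (-1) < of_int (2 * n + 1)" "real_of_int (2 * n + 1) < of_int 1" by simp_all
  then have "-1 < 2 * n + 1" "2 * n + 1 < 1" by (simp_all only: of_int_less_iff)
  then show False by presburger
qed

lemma has_mellin_rational:
  assumes s: "-1 < Re s" "Re s < 1"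
  shows "has_mellin (\<lambda>x. of_real (2 * x / (x^2 + 1))) s (of_real pi / cos (of_real pi * s / 2))"
proof -
  define A where "A = {s. -1 < Re s} \<inter> {s. Re s < 1}"
  define g where "g = (\<lambda>x. complex_of_real (2 * x / (x^2 + 1)))"
  have gm [measurable]: "g \<in> borel_measurable borel" by (simp add: g_def)
  have real: "has_mellin g (of_real t) (of_real pi / cos (of_real pi * of_real t / 2))" if t: "-1 < t" "t < 1" for t
  proof (rule has_mellin_absI)
    have eq: "complex_of_real x powr (of_real t - 1) * g x = of_real (x powr (t - 1) * (2 * x / (x^2 + 1)))"
      if "x \<in> {0<..}" for x
      using that powr_of_real[of x "t - 1"] by (simp add: g_def)
    have "(\<lambda>x. complex_of_real (x powr (t - 1) * (2 * x / (x^2 + 1)))) absolutely_integrable_on {0<..}"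
      using absolutely_integrable_linear[OF conjunct1[OF beta_substitution[OF t]] bounded_linear_of_real[where 'a = complex]]
      by (simp only: o_def)
    then show "(\<lambda>x. complex_of_real x powr (of_real t - 1) * g x) absolutely_integrable_on {0<..}"
      by (rule set_integrable_cong[THEN iffD1, rotated -1]) (use eq in auto)
    have "integral {0<..} (\<lambda>x. complex_of_real x powr (of_real t - 1) * g x) =
          integral {0<..} (\<lambda>x. complex_of_real (x powr (t - 1) * (2 * x / (x^2 + 1))))"
      by (rule integral_cong) (use eq in auto)
    also have "\<dots> = of_real (Beta ((t + 1) / 2) (1 - (t + 1) / 2))"
      using integral_linear[OF set_lebesgue_integral_eq_integral(1)[OF conjunct1[OF beta_substitution[OF t]]] bounded_linear_of_real[where 'a = complex]]
        conjunct2[OF beta_substitution[OF t]] by (simp only: o_def)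
    also have "\<dots> = of_real pi / cos (of_real pi * of_real t / 2)" by (rule Beta_reflection_half[OF t])
    finally show "integral {0<..} (\<lambda>x. complex_of_real x powr (of_real t - 1) * g x) = of_real pi / cos (of_real pi * of_real t / 2)" .
  qed measurable
  have int: "set_integrable lborel {0<..} (\<lambda>x. of_real x powr (s - 1) * g x)" if "s \<in> A" for s
    by (rule set_integrable_powr_bound[where s' = "of_real (Re s)"])
       (use real[of "Re s"] that in \<open>auto simp: has_mellin_iff A_def\<close>)
  define D where "D = (\<lambda>s. (LINT x:{0<..}|lborel. of_real x powr (s - 1) * g x) - of_real pi / cos (of_real pi * s / 2))"
  have op: "open A" unfolding A_def by (intro open_Int open_halfspace_Re_gt open_halfspace_Re_lt)
  have "D s = 0"
  proof (rule analytic_continuation[of D A "complex_of_real ` {-1<..<1}" 0])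
    show "D holomorphic_on A"
      unfolding D_def
      by (intro holomorphic_intros holomorphic_on_powr_integral op int) (auto simp: A_def cos_half_pi_nonzero)
    show "connected A" unfolding A_def
      by (intro convex_connected convex_Int convex_halfspace_Re_gt convex_halfspace_Re_lt)
    show "0 islimpt complex_of_real ` {-1<..<1}"
    proof (unfold islimpt_approachable, intro allI impI)
      fix e :: real assume e: "e > 0"
      define x where "x = min (e / 2) (1 / 2)"
      have "x > 0" "x < e" "x < 1" using e by (auto simp: x_def)
      then show "\<exists>x'\<in>complex_of_real ` {-1<..<1}. x' \<noteq> 0 \<and> dist x' 0 < e"
        by (intro bexI[of _ "of_real x"]) auto
    qed
    show "D z = 0" if "z \<in> complex_of_real ` {-1<..<1}" for z
      using that real by (auto simp: D_def has_mellin_iff)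
  qed (use s op in \<open>auto simp: A_def\<close>)
  then show ?thesis using int[of s] s by (simp add: has_mellin_iff D_def g_def A_def)
qed

lemma has_vector_derivative_powr_div:
  assumes "x > 0" "z \<noteq> 0"
  shows "((\<lambda>x. complex_of_real x powr z / z) has_vector_derivative of_real x powr (z - 1)) (at x)"
proof -
  have "((\<lambda>w. w powr z / z) has_field_derivative (of_real x powr (z - 1))) (at (complex_of_real x))"
    using assms by (auto intro!: derivative_eq_intros)
  then show ?thesis by (rule has_vector_derivative_real_field)
qed

lemma isCont_of_real_powr: "x > 0 \<Longrightarrow> isCont (\<lambda>x. complex_of_real x powr z) x"
  by (intro continuous_intros) auto

lemma integral_powr_Ioc:
  assumes z: "Re z > 0"
  shows "set_integrable lborel {0<..1} (\<lambda>x. complex_of_real x powr (z - 1))"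
    and "(LINT x:{0<..1}|lborel. complex_of_real x powr (z - 1)) = 1 / z"
proof -
  have z0: "z \<noteq> 0" using z by auto
  have "set_integrable lborel {0..1} (\<lambda>t. t powr (Re z - 1) * (1 - t) powr (1 - 1))"
    by (rule integrable_Beta) (use z in auto)
  then have "set_integrable lborel {0<..<1} (\<lambda>t. t powr (Re z - 1) * (1 - t) powr (1 - 1))"
    by (rule set_integrable_subset) auto
  then have r: "integrable lborel (\<lambda>x. indicator {0<..<1} x *\<^sub>R (x powr (Re z - 1)))"
    unfolding set_integrable_def
    by (rule Bochner_Integration.integrable_cong[THEN iffD1, rotated -1]) (auto simp: indicator_def)
  have m: "(\<lambda>x. indicator {0<..1} x *\<^sub>R (complex_of_real x powr (z - 1))) \<in> borel_measurable lborel"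
    by measurable
  have "integrable lborel (\<lambda>x. indicator {0<..1} x *\<^sub>R (complex_of_real x powr (z - 1)))"
  proof (rule Bochner_Integration.integrable_bound[OF r m])
    have "AE x in lborel. x \<noteq> (1 :: real)" by (rule AE_lborel_singleton)
    then show "AE x in lborel. norm (indicator {0<..1} x *\<^sub>R (complex_of_real x powr (z - 1))) \<le> norm (indicator {0<..<1} x *\<^sub>R (x powr (Re z - 1)))"
      by eventually_elim (auto simp: indicator_def norm_of_real_powr)
  qed
  then show int: "set_integrable lborel {0<..1} (\<lambda>x. complex_of_real x powr (z - 1))"
    by (simp add: set_integrable_def)
  have "(LBINT x=ereal 0..ereal 1. complex_of_real x powr (z - 1)) = 1 / z - 0"
  proof (rule interval_integral_FTC_integrable[where F = "\<lambda>x. complex_of_real x powr z / z"])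
    show "set_integrable lborel (einterval (ereal 0) (ereal 1)) (\<lambda>x. complex_of_real x powr (z - 1))"
    proof -
      have "{0<..<1::real} \<in> sets lborel" "{0<..<1::real} \<subseteq> {0<..1}" by auto
      from set_integrable_subset[OF int this] show ?thesis by simp
    qed
    have "((\<lambda>x. complex_of_real x powr z / z) \<longlongrightarrow> 0 / z) (at_right 0)"
    proof (rule tendsto_divide[OF tendsto_norm_zero_cancel tendsto_const z0])
      have "((\<lambda>x::real. x powr Re z) \<longlongrightarrow> 0) (at_right 0)"
        by (rule tendsto_zero_powrI[OF tendsto_ident_at tendsto_const _ z]) (simp add: eventually_at_filter)
      then show "((\<lambda>x. norm (complex_of_real x powr z)) \<longlongrightarrow> 0) (at_right 0)"
        by (rule tendsto_cong[THEN iffD2, rotated]) (auto simp: eventually_at_filter norm_of_real_powr)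
    qed
    then show "(((\<lambda>x. complex_of_real x powr z / z) \<circ> real_of_ereal) \<longlongrightarrow> 0) (at_right (ereal 0))"
      by (simp add: ereal_tendsto_simps1)
    have "((\<lambda>x. complex_of_real x powr z / z) \<longlongrightarrow> of_real 1 powr z / z) (at_left 1)"
      using isCont_of_real_powr[of 1 z] z0 unfolding isCont_def
      by (intro tendsto_divide tendsto_const) (auto intro: tendsto_within_subset)
    then show "(((\<lambda>x. complex_of_real x powr z / z) \<circ> real_of_ereal) \<longlongrightarrow> 1 / z) (at_left (ereal 1))"
      by (simp add: ereal_tendsto_simps1)
  qed (use z0 in \<open>auto intro!: has_vector_derivative_powr_div isCont_of_real_powr\<close>)
  then show "(LINT x:{0<..1}|lborel. complex_of_real x powr (z - 1)) = 1 / z"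
    by (simp add: interval_integral_Ioc)
qed

lemma integral_powr_Ioi:
  assumes z: "Re z < 0"
  shows "set_integrable lborel {1<..} (\<lambda>x. complex_of_real x powr (z - 1))"
    and "(LINT x:{1<..}|lborel. complex_of_real x powr (z - 1)) = - (1 / z)"
proof -
  have z0: "z \<noteq> 0" using z by auto
  have "set_integrable lborel (einterval (ereal 1) \<infinity>) (\<lambda>x. x powr (Re z - 1))"
  proof (rule interval_integral_FTC_nonneg(1)[where F = "\<lambda>x. x powr (Re z) / Re z" and A = "1 / Re z" and B = 0])
    show "DERIV (\<lambda>x. x powr Re z / Re z) x :> x powr (Re z - 1)" if "ereal 1 < ereal x" for x
      using that z by (auto intro!: derivative_eq_intros)
    have "((\<lambda>x. x powr Re z / Re z) \<longlongrightarrow> 0 / Re z) at_top"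
      using z by (intro tendsto_divide tendsto_const tendsto_neg_powr filterlim_ident) auto
    then show "(((\<lambda>x. x powr Re z / Re z) \<circ> real_of_ereal) \<longlongrightarrow> 0) (at_left \<infinity>)"
      by (simp add: ereal_tendsto_simps1)
    have "((\<lambda>x. x powr Re z / Re z) \<longlongrightarrow> 1 powr Re z / Re z) (at_right 1)"
      using z by (intro tendsto_intros) auto
    then show "(((\<lambda>x. x powr Re z / Re z) \<circ> real_of_ereal) \<longlongrightarrow> 1 / Re z) (at_right (ereal 1))"
      by (simp add: ereal_tendsto_simps1)
    show "isCont (\<lambda>x. x powr (Re z - 1)) x" if "ereal 1 < ereal x" for x
      using that by (intro continuous_intros) auto
  qed auto
  then have r: "integrable lborel (\<lambda>x. indicator {1<..} x *\<^sub>R (x powr (Re z - 1)))"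
    by (simp add: set_integrable_def)
  have m: "(\<lambda>x. indicator {1<..} x *\<^sub>R (complex_of_real x powr (z - 1))) \<in> borel_measurable lborel"
    by measurable
  have "integrable lborel (\<lambda>x. indicator {1<..} x *\<^sub>R (complex_of_real x powr (z - 1)))"
    by (rule Bochner_Integration.integrable_bound[OF r m]) (auto simp: indicator_def norm_of_real_powr)
  then show int: "set_integrable lborel {1<..} (\<lambda>x. complex_of_real x powr (z - 1))"
    by (simp add: set_integrable_def)
  have "(LBINT x=ereal 1..\<infinity>. complex_of_real x powr (z - 1)) = 0 - 1 / z"
  proof (rule interval_integral_FTC_integrable[where F = "\<lambda>x. complex_of_real x powr z / z"])
    show "set_integrable lborel (einterval (ereal 1) \<infinity>) (\<lambda>x. complex_of_real x powr (z - 1))"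
      using int by simp
    have "((\<lambda>x. complex_of_real x powr z / z) \<longlongrightarrow> 0 / z) at_top"
      using z z0 by (intro tendsto_divide tendsto_const tendsto_neg_powr_complex_of_real filterlim_ident)
    then show "(((\<lambda>x. complex_of_real x powr z / z) \<circ> real_of_ereal) \<longlongrightarrow> 0) (at_left \<infinity>)"
      by (simp add: ereal_tendsto_simps1)
    have "((\<lambda>x. complex_of_real x powr z / z) \<longlongrightarrow> of_real 1 powr z / z) (at_right 1)"
      using isCont_of_real_powr[of 1 z] z0 unfolding isCont_def
      by (intro tendsto_divide tendsto_const) (auto intro: tendsto_within_subset)
    then show "(((\<lambda>x. complex_of_real x powr z / z) \<circ> real_of_ereal) \<longlongrightarrow> 1 / z) (at_right (ereal 1))"
      by (simp add: ereal_tendsto_simps1)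
  qed (use z0 in \<open>auto intro!: has_vector_derivative_powr_div isCont_of_real_powr\<close>)
  then show "(LINT x:{1<..}|lborel. complex_of_real x powr (z - 1)) = - (1 / z)"
    by (simp add: interval_integral_to_infinity_eq)
qed

lemma set_integral_linear_combination:
  fixes f g h k :: "real \<Rightarrow> complex" and c d :: complex
  assumes "set_integrable M S f" "set_integrable M S g" "set_integrable M S h"
    and "\<forall>x\<in>S. k x = f x + c * g x + d * h x"
  shows "set_integrable M S k"
    and "(LINT x:S|M. k x) = (LINT x:S|M. f x) + c * (LINT x:S|M. g x) + d * (LINT x:S|M. h x)"
proof -
  have eq: "(\<lambda>x. indicator S x *\<^sub>R k x) =
     (\<lambda>x. indicator S x *\<^sub>R f x + c * (indicator S x *\<^sub>R g x) + d * (indicator S x *\<^sub>R h x))"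
    using assms(4) by (auto simp: indicator_def fun_eq_iff)
  show "set_integrable M S k"
    using assms(1-3) unfolding set_integrable_def eq
    by (intro Bochner_Integration.integrable_add integrable_mult_right)
  show "(LINT x:S|M. k x) = (LINT x:S|M. f x) + c * (LINT x:S|M. g x) + d * (LINT x:S|M. h x)"
    using assms(1-3) unfolding set_integrable_def set_lebesgue_integral_def eq
    by (simp only: Bochner_Integration.integral_add Bochner_Integration.integrable_add
          integrable_mult_right integral_mult_right_zero)
qed

subsection \<open>Partial fractions\<close>

lemma cot_partial_fractions:
  fixes z :: complex
  assumes z: "z \<notin> \<int>"
  shows "(\<lambda>m. \<Sum>n<m. 1 / (z + of_nat n) + 1 / (z - 1 - of_nat n)) \<longlonglongrightarrow> of_real pi * cot (of_real pi * z)"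
proof -
  have "1 - z \<notin> \<int>" using z Ints_diff[OF Ints_1, of "1 - z"] unfolding diff_diff_eq2 by (metis add_diff_cancel_left')
  then have nz: "z \<notin> \<int>\<^sub>\<le>\<^sub>0" "1 - z \<notin> \<int>\<^sub>\<le>\<^sub>0" "z \<noteq> 0" "1 - z \<noteq> 0"
    using z nonpos_Ints_subset_Ints[where 'a = complex] by (blast, blast, metis Ints_0, metis Ints_0)
  have sin_nz: "sin (of_real pi * z) \<noteq> 0" if "z \<notin> \<int>" for z :: complex
    using that by (simp add: sin_eq_0 mult.commute[of _ "of_real pi"]) (metis Ints_of_int)
  have G: "Gamma z * Gamma (1 - z) = of_real pi / sin (of_real pi * z)" for z :: complex
    by (rule Gamma_reflection_complex)
  have Gnz: "Gamma z * Gamma (1 - z) \<noteq> 0"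
    using sin_nz[OF z] by (simp add: G)
  have "((\<lambda>z. Gamma z * Gamma (1 - z)) has_field_derivative
          (Gamma z * Digamma z * Gamma (1 - z) - Gamma z * (Gamma (1 - z) * Digamma (1 - z)))) (at z)"
    using nz by (auto intro!: derivative_eq_intros)
  moreover have "((\<lambda>z. Gamma z * Gamma (1 - z)) has_field_derivative
          (- (of_real pi * (cos (of_real pi * z) * of_real pi)) / (sin (of_real pi * z))^2)) (at z)"
    unfolding G using sin_nz[OF z] by (auto intro!: derivative_eq_intros simp: power2_eq_square)
  ultimately have "Gamma z * Digamma z * Gamma (1 - z) - Gamma z * (Gamma (1 - z) * Digamma (1 - z)) =
      - (of_real pi * (cos (of_real pi * z) * of_real pi)) / (sin (of_real pi * z))^2"
    by (rule DERIV_unique)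
  then have "Gamma z * Gamma (1 - z) * (Digamma z - Digamma (1 - z)) =
      - (of_real pi * (cos (of_real pi * z) * of_real pi)) / (sin (of_real pi * z))^2"
    by (simp only: ring_distribs mult_ac)
  also have "\<dots> = Gamma z * Gamma (1 - z) * (- (of_real pi * cot (of_real pi * z)))"
    using sin_nz[OF z] by (simp add: G cot_def field_simps power2_eq_square)
  finally have "Digamma z - Digamma (1 - z) = - (of_real pi * cot (of_real pi * z))"
    using Gnz by (simp only: mult_cancel_left) blast
  then have D: "Digamma (1 - z) - Digamma z = of_real pi * cot (of_real pi * z)"
    by (metis minus_diff_eq minus_minus)
  have "(\<lambda>m. (of_real (ln (real m)) - (\<Sum>n<m. inverse ((1 - z) + of_nat n))) -
             (of_real (ln (real m)) - (\<Sum>n<m. inverse (z + of_nat n)))) \<longlonglongrightarrow> Digamma (1 - z) - Digamma z"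
    using nz by (intro tendsto_diff Digamma_LIMSEQ)
  also have "(\<lambda>m. (of_real (ln (real m)) - (\<Sum>n<m. inverse ((1 - z) + of_nat n))) -
             (of_real (ln (real m)) - (\<Sum>n<m. inverse (z + of_nat n)))) =
           (\<lambda>m. \<Sum>n<m. 1 / (z + of_nat n) + 1 / (z - 1 - of_nat n))"
  proof
    fix m
    have "1 / (z - 1 - of_nat n) = - inverse ((1 - z) + of_nat n)" for n
    proof -
      have "z - 1 - of_nat n = - ((1 - z) + of_nat n)" by simp
      then show ?thesis by (simp only: inverse_eq_divide minus_divide_right)
    qed
    then show "(of_real (ln (real m)) - (\<Sum>n<m. inverse ((1 - z) + of_nat n))) -
             (of_real (ln (real m)) - (\<Sum>n<m. inverse (z + of_nat n))) =
             (\<Sum>n<m. 1 / (z + of_nat n) + 1 / (z - 1 - of_nat n))"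
      by (simp add: sum.distrib sum_negf sum_subtractf inverse_eq_divide)
  qed
  finally show ?thesis by (simp only: D)
qed

lemma cot_partial_fractions':
  fixes z :: complex
  assumes z: "z \<notin> \<int>"
  shows "(\<lambda>m. \<Sum>n<m. 1 / (z - of_nat n) + 1 / (z + 1 + of_nat n)) \<longlonglongrightarrow> of_real pi * cot (of_real pi * z)"
proof -
  have "z + 1 \<notin> \<int>" using z by (metis Ints_1 Ints_diff add_diff_cancel_right')
  from cot_partial_fractions[OF this]
  have "(\<lambda>m. \<Sum>n<m. 1 / (z - of_nat n) + 1 / (z + 1 + of_nat n)) \<longlonglongrightarrow> of_real pi * cot (of_real pi * (z + 1))"
    by (simp add: add.commute)
  moreover have "cot (of_real pi * (z + 1)) = cot (of_real pi * z)"
  proof -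
    have "sin (complex_of_real pi) = 0" "cos (complex_of_real pi) = -1"
      by (simp_all add: sin_of_real cos_of_real)
    then show ?thesis by (simp add: cot_def distrib_left sin_add cos_add)
  qed
  ultimately show ?thesis by simp
qed

lemma periodic_mult:
  assumes "\<And>n. a (n + N) = a (n :: nat)"
  shows "a (r + k * N) = a r"
proof (induction k)
  case (Suc k)
  have "a (r + Suc k * N) = a ((r + k * N) + N)" by (simp add: algebra_simps)
  with Suc assms show ?case by metis
qed simp

lemma sum_lessThan_mult:
  "(\<Sum>j<m * N. f j) = (\<Sum>n<m. \<Sum>r<N. f (r + n * N :: nat))" for f :: "nat \<Rightarrow> complex"
proof -
  have "(\<Sum>j=n * N..<n * N + N. f j) = (\<Sum>r<N. f (r + n * N))" for n
    using sum.shift_bounds_nat_ivl[of f 0 "n * N" N] by (simp add: atLeast0LessThan add.commute)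
  then show ?thesis by (simp add: sum.nat_group [symmetric])
qed

lemma periodic_bounded:
  fixes a :: "nat \<Rightarrow> complex"
  assumes N: "N > 0" and per: "\<And>n. a (n + N) = a n"
  shows "\<exists>B>0. \<forall>n. norm (a n) \<le> B"
proof -
  have "norm (a n) \<le> (\<Sum>r<N. norm (a r)) + 1" for n
  proof -
    have "norm (a n) = norm (a (n mod N))"
      using periodic_mult[of a N "n mod N" "n div N", OF per] by simp
    also have "\<dots> \<le> (\<Sum>r<N. norm (a r))"
      using N by (intro member_le_sum) auto
    finally show ?thesis by simp
  qed
  moreover have "(\<Sum>r<N. norm (a r)) + 1 > 0" by (simp add: add_nonneg_pos sum_nonneg)
  ultimately show ?thesis by blast
qed

lemma periodic_cot_partial_fractions:
  fixes a :: "nat \<Rightarrow> complex" and w :: complex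
  assumes N: "N > 0" and per: "\<And>n. a (n + N) = a n" and even: "\<And>r. r \<le> N \<Longrightarrow> a (N - r) = a r"
    and w: "w \<notin> \<int>" and summ: "summable (\<lambda>j. a (Suc j) * (2 * w / (w^2 - of_nat (Suc j)^2)))"
  shows "(\<lambda>j. a (Suc j) * (2 * w / (w^2 - of_nat (Suc j)^2))) sums
           ((\<Sum>r<N. a r * (of_real pi / of_nat N * cot (of_real pi * (w - of_nat r) / of_nat N))) - a 0 / w)"
proof -
  define t where "t = (\<lambda>j. a (Suc j) * (2 * w / (w^2 - of_nat (Suc j)^2)))"
  define T where "T = (\<Sum>r<N. a r * (of_real pi / of_nat N * cot (of_real pi * (w - of_nat r) / of_nat N)))"
  have nz: "w - of_nat j \<noteq> 0" "w + of_nat j \<noteq> 0" for j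
  proof -
    show "w - of_nat j \<noteq> 0" using w by auto
    show "w + of_nat j \<noteq> 0" using w by (metis Ints_minus Ints_of_nat add_eq_0_iff2)
  qed
  have notin: "(w - of_nat r) / of_nat N \<notin> \<int>" for r
  proof
    assume "(w - of_nat r) / of_nat N \<in> \<int>"
    then have "of_nat N * ((w - of_nat r) / of_nat N) + of_nat r \<in> \<int>" by (intro Ints_add Ints_mult) auto
    then show False using w N by simp
  qed
  have "(\<lambda>m. \<Sum>r<N. a r / of_nat N * (\<Sum>n<m. 1 / ((w - of_nat r) / of_nat N - of_nat n) + 1 / ((w - of_nat r) / of_nat N + 1 + of_nat n)))
      \<longlonglongrightarrow> (\<Sum>r<N. a r / of_nat N * (of_real pi * cot (of_real pi * ((w - of_nat r) / of_nat N))))"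
    by (intro tendsto_intros cot_partial_fractions' notin)
  also have "(\<Sum>r<N. a r / of_nat N * (of_real pi * cot (of_real pi * ((w - of_nat r) / of_nat N)))) = T"
    by (simp add: T_def)
  also have "(\<lambda>m. \<Sum>r<N. a r / of_nat N * (\<Sum>n<m. 1 / ((w - of_nat r) / of_nat N - of_nat n) + 1 / ((w - of_nat r) / of_nat N + 1 + of_nat n)))
     = (\<lambda>m. a 0 / w + (\<Sum>j<m * N. t j) - a (m * N) / (w - of_nat (m * N)))"
  proof
    fix m
    have am: "a (r + n * N) = a r" for r n by (rule periodic_mult) (rule per)
    have "(\<Sum>r<N. a r / of_nat N * (\<Sum>n<m. 1 / ((w - of_nat r) / of_nat N - of_nat n) + 1 / ((w - of_nat r) / of_nat N + 1 + of_nat n)))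
        = (\<Sum>n<m. \<Sum>r<N. a r / (w - of_nat (r + n * N)) + a r / (w + of_nat (N - r + n * N)))"
    proof -
      have *: "a r / of_nat N * (1 / ((w - of_nat r) / of_nat N - of_nat n) + 1 / ((w - of_nat r) / of_nat N + 1 + of_nat n))
          = a r / (w - of_nat (r + n * N)) + a r / (w + of_nat (N - r + n * N))" if "r < N" for r n
      proof -
        have "(w - of_nat r) / of_nat N - of_nat n = (w - of_nat (r + n * N)) / of_nat N"
             "(w - of_nat r) / of_nat N + 1 + of_nat n = (w + of_nat (N - r + n * N)) / of_nat N"
          using N that by (auto simp: field_simps of_nat_diff)
        then show ?thesis using N by (simp add: algebra_simps add_divide_distrib)
      qed
      show ?thesis
        unfolding sum_distrib_left by (subst sum.swap, intro sum.cong refl) (use * in auto)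
    qed
    also have "\<dots> = (\<Sum>j<m * N. a j / (w - of_nat j)) + (\<Sum>j<m * N. a (Suc j) / (w + of_nat (Suc j)))"
    proof -
      have "(\<Sum>r<N. a r / (w + of_nat (N - r + n * N))) = (\<Sum>r<N. a (Suc (r + n * N)) / (w + of_nat (Suc (r + n * N))))" for n
      proof (rule sum.reindex_bij_witness[where i = "\<lambda>r. N - Suc r" and j = "\<lambda>r. N - Suc r"])
        fix r assume r: "r \<in> {..<N}"
        then have "Suc (N - Suc r + n * N) = (N - r) + n * N" by auto
        then show "a (Suc (N - Suc r + n * N)) / (w + of_nat (Suc (N - Suc r + n * N))) = a r / (w + of_nat (N - r + n * N))"
          using r by (simp only: am even lessThan_iff less_imp_le)
      qed auto
      then show ?thesis by (simp add: sum_lessThan_mult sum.distrib am)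
    qed
    also have "(\<Sum>j<m * N. a j / (w - of_nat j)) = a 0 / w + (\<Sum>j<m * N. a (Suc j) / (w - of_nat (Suc j))) - a (m * N) / (w - of_nat (m * N))"
      using sum.lessThan_Suc_shift[of "\<lambda>j. a j / (w - of_nat j)" "m * N"] by (simp add: algebra_simps)
    also have "a 0 / w + (\<Sum>j<m * N. a (Suc j) / (w - of_nat (Suc j))) - a (m * N) / (w - of_nat (m * N)) + (\<Sum>j<m * N. a (Suc j) / (w + of_nat (Suc j)))
        = a 0 / w + (\<Sum>j<m * N. t j) - a (m * N) / (w - of_nat (m * N))"
    proof -
      have "a (Suc j) / (w - of_nat (Suc j)) + a (Suc j) / (w + of_nat (Suc j)) = t j" for j
      proof -
        define k :: complex where "k = of_nat (Suc j)"
        have k: "w - k \<noteq> 0" "w + k \<noteq> 0" using nz[of "Suc j"] by (auto simp only: k_def)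
        have "w^2 - k^2 = (w - k) * (w + k)" by (simp add: algebra_simps power2_eq_square)
        then show ?thesis using k unfolding t_def k_def [symmetric] by (simp add: divide_simps) (simp add: algebra_simps)
      qed
      then show ?thesis by (simp add: sum.distrib [symmetric])
    qed
    finally show "(\<Sum>r<N. a r / of_nat N * (\<Sum>n<m. 1 / ((w - of_nat r) / of_nat N - of_nat n) + 1 / ((w - of_nat r) / of_nat N + 1 + of_nat n)))
      = a 0 / w + (\<Sum>j<m * N. t j) - a (m * N) / (w - of_nat (m * N))" .
  qed
  finally have lim1: "(\<lambda>m. a 0 / w + (\<Sum>j<m * N. t j) - a (m * N) / (w - of_nat (m * N))) \<longlonglongrightarrow> T" .
  have filt: "filterlim (\<lambda>m. m * N) at_top sequentially"
    using N by (simp add: filterlim_at_top_mono[OF filterlim_ident] eventually_sequentially)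
  have "(\<lambda>n. \<Sum>j<n. t j) \<longlonglongrightarrow> suminf t"
    using summ summable_LIMSEQ unfolding t_def by blast
  then have lim2: "(\<lambda>m. \<Sum>j<m * N. t j) \<longlonglongrightarrow> suminf t"
    using filt by (rule filterlim_compose)
  have "(\<lambda>m. a 0 / (w - of_nat (m * N))) \<longlonglongrightarrow> 0"
  proof (rule filterlim_compose[OF _ filt])
    show "(\<lambda>m. a 0 / (w - of_nat m)) \<longlonglongrightarrow> 0"
      proof (rule tendsto_divide_0[OF tendsto_const])
      have "filterlim (\<lambda>m. - complex_of_nat m) at_infinity sequentially"
        using tendsto_of_nat by (simp add: filterlim_at_infinity_conv_norm_at_top)
      from tendsto_add_filterlim_at_infinity[OF tendsto_const[of w] this]
      show "filterlim (\<lambda>m. w - complex_of_nat m) at_infinity sequentially" by simp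
    qed
  qed
  moreover have "a (m * N) = a 0" for m using periodic_mult[of a N 0 m, OF per] by simp
  ultimately have lim3: "(\<lambda>m. a (m * N) / (w - of_nat (m * N))) \<longlonglongrightarrow> 0" by simp
  have "(\<lambda>m. a 0 / w + (\<Sum>j<m * N. t j) - a (m * N) / (w - of_nat (m * N))) \<longlonglongrightarrow> a 0 / w + suminf t - 0"
    by (intro tendsto_intros lim2 lim3)
  from LIMSEQ_unique[OF this lim1] have "suminf t = T - a 0 / w" by (simp add: algebra_simps)
  moreover have "t sums suminf t" using summ unfolding t_def by (rule summable_sums)
  ultimately show ?thesis by (simp only: t_def T_def)
qed

lemma summable_powr_Suc:
  assumes "e < -1"
  shows "summable (\<lambda>n. real (Suc n) powr e)"
proof -
  have "summable (\<lambda>n. real n powr e)" using assms by (simp add: summable_real_powr_iff)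
  then show ?thesis by (subst (asm) summable_Suc_iff [symmetric])
qed

lemma cot_half_exp:
  assumes "exp (2 * \<i> * u) \<noteq> (1 :: complex)"
  shows "cot u = \<i> * (1 + 2 / (exp (2 * \<i> * u) - 1))"
proof -
  define e where "e = exp (\<i> * u)"
  have e: "e \<noteq> 0" "exp (- (\<i> * u)) = inverse e" "exp (2 * \<i> * u) = e^2"
    by (simp_all add: e_def exp_minus exp_double [symmetric] mult.assoc)
  have "e^2 \<noteq> 1" using assms e by simp
  then have "e - inverse e \<noteq> 0" using e(1) by (auto simp: field_simps power2_eq_square)
  have "cot u = ((e + inverse e) / 2) / ((e - inverse e) / (2 * \<i>))"
    using e by (simp add: cot_def cos_exp_eq sin_exp_eq e_def)
  also have "\<dots> = \<i> * ((e + inverse e) / (e - inverse e))"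
  proof -
    have "(p / 2) / (q / (2 * \<i>)) = \<i> * (p / q)" for p q :: complex
      by (cases "q = 0") (auto simp: field_simps)
    then show ?thesis .
  qed
  also have "(e + inverse e) / (e - inverse e) = (e^2 + 1) / (e^2 - 1)"
  proof -
    have "(e + inverse e) / (e - inverse e) = (e * (e + inverse e)) / (e * (e - inverse e))"
      using e(1) by simp
    also have "\<dots> = (e^2 + 1) / (e^2 - 1)" using e(1) by (simp add: algebra_simps power2_eq_square)
    finally show ?thesis .
  qed
  also have "\<dots> = 1 + 2 / (e^2 - 1)" using \<open>e^2 \<noteq> 1\<close> by (simp add: field_simps)
  finally show ?thesis by (simp add: e(3))
qed

locale self_dual =
  fixes N :: nat and a :: "nat \<Rightarrow> complex"
  assumes N: "N > 0"
    and per: "\<And>n. a (n + N) = a n"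
    and even: "\<And>r. r \<le> N \<Longrightarrow> a (N - r) = a r"
    and dual: "\<And>k. (\<Sum>r<N. a r * cis (- 2 * pi * real r * real k / real N)) = of_real (sqrt (real N)) * a k"
begin

lemma bounded: "\<exists>B>0. \<forall>n. norm (a n) \<le> B"
  by (rule periodic_bounded[OF N]) (rule per)

definition E :: "real \<Rightarrow> complex" where
  "E x = (\<Sum>n. a (Suc n) * of_real (exp (- (real (Suc n) * x))))"

lemma summable_exp: "x > 0 \<Longrightarrow> summable (\<lambda>n. norm (a (Suc n) * of_real (exp (- (real (Suc n) * x)))))"
proof -
  assume x: "x > 0"
  obtain B where B: "B > 0" "\<And>n. norm (a n) \<le> B"
    using bounded by blast
  have g: "summable (\<lambda>n. B * exp (-x) ^ n)"
    using x by (intro summable_mult summable_geometric) simp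
  show ?thesis
  proof (rule summable_comparison_test'[OF g])
    fix n
    have "exp (- (real (Suc n) * x)) = exp (-x) * exp (-x) ^ n"
      by (simp add: exp_of_nat_mult [symmetric] exp_add [symmetric] algebra_simps)
    also have "\<dots> \<le> exp (-x) ^ n" using x by (simp add: mult_left_le_one_le)
    finally show "norm (norm (a (Suc n) * of_real (exp (- (real (Suc n) * x))))) \<le> B * exp (-x) ^ n"
      using B by (simp add: norm_mult mult_mono)
  qed
qed

lemma E_sums: "x > 0 \<Longrightarrow> (\<lambda>n. a (Suc n) * of_real (exp (- (real (Suc n) * x)))) sums E x"
  unfolding E_def by (rule summable_sums[OF summable_norm_cancel[OF summable_exp]])

lemma summable_poisson:
  assumes x: "x > 0"
  shows "summable (\<lambda>n. norm (a (Suc n) * of_real (2 * x / (x^2 + (2 * pi * real (Suc n) / real N)^2))))"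
proof -
  obtain B where B: "B > 0" "\<And>n. norm (a n) \<le> B"
    using bounded by blast
  define C where "C = (2 * pi / real N)^2"
  have C: "C > 0" using N by (simp add: C_def)
  have "summable (\<lambda>n. 1 / (real (Suc n))^2)"
    using inverse_power_summable[of 2, where 'a = real] by (subst summable_Suc_iff) (simp add: inverse_eq_divide)
  then have g: "summable (\<lambda>n. B * (2 * x / C * (1 / (real (Suc n))^2)))" by (intro summable_mult)
  show ?thesis
  proof (rule summable_comparison_test'[OF g])
    fix n
    have eq: "(2 * pi * real (Suc n) / real N)^2 = C * (real (Suc n))^2"
      by (simp only: C_def power_mult_distrib [symmetric]) simp
    have pos: "C * (real (Suc n))^2 > 0" using C by simp
    have "2 * x / (x^2 + (2 * pi * real (Suc n) / real N)^2) \<le> 2 * x / (C * (real (Suc n))^2)"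
      unfolding eq using x pos by (intro divide_left_mono) (auto intro!: mult_pos_pos add_nonneg_pos simp del: of_nat_Suc)
    also have "\<dots> = 2 * x / C * (1 / (real (Suc n))^2)" by simp
    finally have le: "2 * x / (x^2 + (2 * pi * real (Suc n) / real N)^2) \<le> 2 * x / C * (1 / (real (Suc n))^2)" .
    have nn: "0 \<le> 2 * x / (x^2 + (2 * pi * real (Suc n) / real N)^2)"
      using x by (intro divide_nonneg_nonneg add_nonneg_nonneg) auto
    show "norm (norm (a (Suc n) * of_real (2 * x / (x^2 + (2 * pi * real (Suc n) / real N)^2)))) \<le> B * (2 * x / C * (1 / (real (Suc n))^2))"
      unfolding norm_mult real_norm_def norm_of_real abs_of_nonneg[OF nn] abs_mult abs_norm_cancel
      using B le nn by (intro mult_mono) (auto simp: less_imp_le)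
  qed
qed

lemma cot_sum_eq_exp_sum:
  assumes x: "x > 0"
  defines "w \<equiv> \<i> * of_real (real N * x / (2 * pi))"
  shows "(\<Sum>r<N. a r * (of_real pi / of_nat N * cot (of_real pi * (w - of_nat r) / of_nat N)))
          = - \<i> * of_real pi / of_real (sqrt (real N)) * (a 0 + 2 * E x)"
proof -
  define z where "z = complex_of_real (exp (-x))"
  define \<omega> where "\<omega> = (\<lambda>r. cis (- 2 * pi * real r / real N))"
  have nz: "norm z < 1" using x by (simp add: z_def)
  have nw: "norm (z * \<omega> r) < 1" for r using nz by (simp add: norm_mult \<omega>_def)
  have cot_eq: "cot (of_real pi * (w - of_nat r) / of_nat N) = - \<i> * (1 + 2 * (\<Sum>k. (z * \<omega> r) ^ Suc k))" for r
  proof -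
    have arg: "2 * \<i> * (of_real pi * (w - of_nat r) / of_nat N) = of_real (-x) + \<i> * of_real (- 2 * pi * real r / real N)"
      using N by (simp add: w_def field_simps)
    have ex: "exp (2 * \<i> * (of_real pi * (w - of_nat r) / of_nat N)) = z * \<omega> r"
      unfolding arg exp_add by (simp only: z_def \<omega>_def cis_conv_exp exp_of_real)
    have ne: "z * \<omega> r \<noteq> 1" using nw[of r] by auto
    have "cot (of_real pi * (w - of_nat r) / of_nat N) = \<i> * (1 + 2 / (z * \<omega> r - 1))"
      using cot_half_exp[of "of_real pi * (w - of_nat r) / of_nat N"] ne by (simp only: ex not_False_eq_True)
    also have "1 + 2 / (z * \<omega> r - 1) = - (1 + 2 * (z * \<omega> r * (1 / (1 - z * \<omega> r))))"
    proof -
      have "1 + 2 / (q - 1) = - (1 + 2 * (q * (1 / (1 - q))))" if "q \<noteq> 1" for q :: complex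
        using that by (simp add: divide_simps) (simp add: algebra_simps)
      then show ?thesis using ne .
    qed
    also have "z * \<omega> r * (1 / (1 - z * \<omega> r)) = (\<Sum>k. (z * \<omega> r) ^ Suc k)"
      using suminf_geometric[OF nw[of r]] suminf_mult[OF summable_geometric[OF nw[of r]], of "z * \<omega> r"] by simp
    finally show ?thesis by (simp only: mult_minus_left mult_minus_right)
  qed
  have sm: "summable (\<lambda>k. (z * \<omega> r) ^ Suc k)" for r
    using summable_mult[OF summable_geometric[OF nw[of r]], of "z * \<omega> r"] by simp
  have sq: "of_real (sqrt (real N)) * of_real (sqrt (real N)) = (of_nat N :: complex)"
    by (simp flip: of_real_mult)
  have sq0: "complex_of_real (sqrt (real N)) \<noteq> 0" using N by simp
  have d0: "(\<Sum>r<N. a r) = of_real (sqrt (real N)) * a 0" using dual[of 0] by simp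
  have "(\<Sum>r<N. a r * (\<Sum>k. (z * \<omega> r) ^ Suc k)) = (\<Sum>k. \<Sum>r<N. a r * (z * \<omega> r) ^ Suc k)"
    using sm by (subst suminf_sum) (auto intro!: sum.cong suminf_mult [symmetric] summable_mult simp del: power_Suc)
  also have "(\<lambda>k. \<Sum>r<N. a r * (z * \<omega> r) ^ Suc k) = (\<lambda>k. of_real (sqrt (real N)) * (a (Suc k) * of_real (exp (- (real (Suc k) * x)))))"
  proof
    fix k
    have "\<omega> r ^ Suc k = cis (- 2 * pi * real r * real (Suc k) / real N)" for r
      unfolding \<omega>_def Complex.DeMoivre by (rule arg_cong[of _ _ cis]) simp
    moreover have "z ^ Suc k = of_real (exp (- (real (Suc k) * x)))"
      unfolding z_def of_real_power [symmetric] exp_of_nat_mult [symmetric] by simp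
    ultimately have "(\<Sum>r<N. a r * (z * \<omega> r) ^ Suc k) = (\<Sum>r<N. a r * cis (- 2 * pi * real r * real (Suc k) / real N)) * of_real (exp (- (real (Suc k) * x)))"
      unfolding power_mult_distrib sum_distrib_right by (intro sum.cong refl) (simp only: mult_ac)
    then show "(\<Sum>r<N. a r * (z * \<omega> r) ^ Suc k) = of_real (sqrt (real N)) * (a (Suc k) * of_real (exp (- (real (Suc k) * x))))"
      unfolding dual by (simp only: mult.assoc)
  qed
  also have "(\<Sum>k. of_real (sqrt (real N)) * (a (Suc k) * of_real (exp (- (real (Suc k) * x))))) = of_real (sqrt (real N)) * E x"
    using E_sums[OF x] by (simp only: sums_unique[OF sums_mult])
  finally have e: "(\<Sum>r<N. a r * (\<Sum>k. (z * \<omega> r) ^ Suc k)) = of_real (sqrt (real N)) * E x" .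
  have "(\<Sum>r<N. a r * (of_real pi / of_nat N * cot (of_real pi * (w - of_nat r) / of_nat N)))
      = - \<i> * of_real pi / of_nat N * ((\<Sum>r<N. a r) + 2 * (\<Sum>r<N. a r * (\<Sum>k. (z * \<omega> r) ^ Suc k)))"
    unfolding cot_eq sum_distrib_left sum.distrib [symmetric]
    by (intro sum.cong refl) (simp add: algebra_simps del: power_Suc)
  also have "\<dots> = - \<i> * of_real pi / of_nat N * (of_real (sqrt (real N)) * (a 0 + 2 * E x))"
    by (simp only: d0 e) (simp add: algebra_simps)
  also have "\<dots> = - \<i> * of_real pi / of_real (sqrt (real N)) * (a 0 + 2 * E x)"
    unfolding sq [symmetric] using sq0 by simp
  finally show ?thesis .
qed

lemma partial_fractions:
  assumes x: "x > 0"
  shows "(\<lambda>n. a (Suc n) * of_real (2 * x / (x^2 + (2 * pi * real (Suc n) / real N)^2))) sums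
           (of_real (sqrt (real N)) * (E x + a 0 / 2) - a 0 / of_real x)"
proof -
  define w where "w = \<i> * complex_of_real (real N * x / (2 * pi))"
  define k where "k = 2 * pi / real N"
  define b where "b = (\<lambda>n. a (Suc n) * complex_of_real (2 * x / (x^2 + (k * real (Suc n))^2)))"
  have k: "k > 0" using N by (simp add: k_def)
  have w: "w = \<i> * of_real (x / k)" using N by (simp add: w_def k_def)
  have notint: "w \<notin> \<int>"
  proof
    assume "w \<in> \<int>"
    then obtain n where n: "w = of_int n" by (auto elim: Ints_cases)
    have "Im w = 0" by (simp add: n)
    then show False using x k by (simp add: w)
  qed
  have t: "a (Suc n) * (2 * w / (w^2 - of_nat (Suc n)^2)) = - \<i> * of_real k * b n" for n
  proof -
    define m where "m = real (Suc n)"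
    have pos: "x^2 + (k * m)^2 > 0" using x by (simp add: add_pos_nonneg)
    have "2 * (x / k) / ((x / k)^2 + m^2) = k * (2 * x / (x^2 + (k * m)^2))"
    proof -
      have "(x / k)^2 + m^2 = (x^2 + (k * m)^2) / k^2"
        using k by (simp add: power_divide power_mult_distrib add_divide_distrib)
      then show ?thesis using k by (simp add: power2_eq_square)
    qed
    moreover have "2 * w / (w^2 - of_nat (Suc n)^2) = - \<i> * of_real (2 * (x / k) / ((x / k)^2 + m^2))"
    proof -
      have "w^2 - of_nat (Suc n)^2 = - of_real ((x / k)^2 + m^2)"
        unfolding w m_def power_mult_distrib by simp
      moreover have "2 * w / (- of_real D) = - \<i> * of_real (2 * (x / k) / D)" for D
        by (simp add: w)
      ultimately show ?thesis by (simp only:)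
    qed
    ultimately show ?thesis by (simp add: b_def m_def del: of_nat_Suc)
  qed
  have b_eq: "b = (\<lambda>n. a (Suc n) * of_real (2 * x / (x^2 + (2 * pi * real (Suc n) / real N)^2)))"
    by (simp add: b_def k_def)
  have "summable b"
    using summable_norm_cancel[OF summable_poisson[OF x]] by (simp only: b_eq)
  then have sm: "summable (\<lambda>n. a (Suc n) * (2 * w / (w^2 - of_nat (Suc n)^2)))"
    unfolding t by (rule summable_mult)
  have "(\<lambda>n. - \<i> * of_real k * b n) sums
          (- \<i> * of_real pi / of_real (sqrt (real N)) * (a 0 + 2 * E x) - a 0 / w)"
    using periodic_cot_partial_fractions[OF N per even notint sm]
    unfolding t cot_sum_eq_exp_sum[OF x, folded w_def] .
  from sums_mult[OF this, of "\<i> / of_real k"]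
  have "b sums (\<i> / of_real k * (- \<i> * of_real pi / of_real (sqrt (real N)) * (a 0 + 2 * E x) - a 0 / w))"
    using k by simp
  also have "\<i> / of_real k * (- \<i> * of_real pi / of_real (sqrt (real N)) * (a 0 + 2 * E x) - a 0 / w)
      = of_real (pi / (k * sqrt (real N))) * (a 0 + 2 * E x) - a 0 / of_real x"
  proof -
    have "\<i> / K * (- \<i> * P / S * Y) = P / (K * S) * Y" if "K \<noteq> 0" for K P S Y :: complex
      using that by (cases "S = 0") (simp_all add: divide_simps mult.assoc [symmetric])
    moreover have "\<i> / K * (A / (\<i> * (X / K))) = A / X" if "K \<noteq> 0" "X \<noteq> 0" for K A X :: complex
      using that by (simp add: divide_simps)
    ultimately show ?thesis
      using k x by (simp add: w right_diff_distrib)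
  qed
  also have "pi / (k * sqrt (real N)) = sqrt (real N) / 2"
    using N by (simp add: k_def field_simps)
  finally show ?thesis by (simp add: b_eq algebra_simps)
qed

subsection \<open>Continuation and functional equation\<close>

definition L :: "complex \<Rightarrow> complex" where
  "L s = (\<Sum>n. a (Suc n) / of_nat (Suc n) powr s)"

definition c :: complex where "c = a 0 / of_real (sqrt (real N))"

definition d :: complex where "d = a 0 / 2"

definition R :: "real \<Rightarrow> complex" where "R x = E x - c / of_real x + d"

lemma summable_norm_L:
  assumes "\<sigma> > 1"
  shows "summable (\<lambda>n. norm (a (Suc n)) * real (Suc n) powr (- \<sigma>))"
proof -
  obtain B where B: "B > 0" "\<And>n. norm (a n) \<le> B"
    using bounded by blast
  have "summable (\<lambda>n. B * real (Suc n) powr (- \<sigma>))"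
    using assms by (intro summable_mult summable_powr_Suc) simp
  then show ?thesis
    by (rule summable_comparison_test') (use B in \<open>simp add: mult_right_mono\<close>)
qed

lemma L_sums:
  assumes "Re s > 1"
  shows "(\<lambda>n. a (Suc n) / of_nat (Suc n) powr s) sums L s"
  unfolding L_def
proof (rule summable_sums, rule summable_norm_cancel)
  have "norm (a (Suc n) / of_nat (Suc n) powr s) = norm (a (Suc n)) * real (Suc n) powr (- Re s)" for n
    using norm_of_real_powr[of "real (Suc n)" s] by (simp add: norm_divide powr_minus_divide del: of_nat_Suc)
  then show "summable (\<lambda>n. norm (a (Suc n) / of_nat (Suc n) powr s))"
    using summable_norm_L[OF assms] by simp
qed

lemma has_mellin_E:
  assumes s: "Re s > 1"
  shows "has_mellin E s (L s * Gamma s)"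
proof -
  have "has_mellin E s ((\<Sum>n. a (Suc n) * of_real (real (Suc n)) powr (-s)) * Gamma s)"
  proof (rule has_mellin_suminf)
    show "has_mellin (\<lambda>x. of_real (exp (-x))) s (Gamma s)"
      by (rule has_mellin_exp) (use s in simp)
    show "summable (\<lambda>n. norm (a (Suc n)) * real (Suc n) powr (- Re s))"
      by (rule summable_norm_L[OF s])
  qed (auto intro: summable_exp E_sums simp del: of_nat_Suc)
  also have "(\<Sum>n. a (Suc n) * of_real (real (Suc n)) powr (-s)) = L s"
    by (simp add: L_def powr_minus divide_inverse)
  finally show ?thesis .
qed

lemma has_mellin_R:
  assumes s: "-1 < Re s" "Re s < 0"
  shows "has_mellin R s (of_real (2 * pi / real N) powr (s - 1) / of_real (sqrt (real N)) * L (1 - s) *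
           (of_real pi / cos (of_real pi * s / 2)))"
proof -
  define k where "k = 2 * pi / real N"
  define q where "q = complex_of_real (sqrt (real N))"
  have k: "k > 0" using N by (simp add: k_def)
  have q: "q \<noteq> 0" using N by (simp add: q_def)
  define m where "m = (\<lambda>n. k * real (Suc n))"
  have m: "m n > 0" for n using k by (simp add: m_def)
  define co where "co = (\<lambda>n. a (Suc n) / (q * of_real (m n)))"
  define g where "g = (\<lambda>x. complex_of_real (2 * x / (x^2 + 1)))"
  have term_eq: "co n * g (1 / m n * x) = 1 / q * (a (Suc n) * of_real (2 * x / (x^2 + (2 * pi * real (Suc n) / real N)^2)))" for n x
  proof -
    have "(2 * (1 / m n * x) / ((1 / m n * x)^2 + 1)) / m n = 2 * x / (x^2 + (m n)^2)"
    proof -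
      have "(1 / m n * x)^2 + 1 = (x^2 + (m n)^2) / (m n)^2"
        using m[of n] by (simp add: power_divide add_divide_distrib)
      then show ?thesis using m[of n] by (simp add: power2_eq_square)
    qed
    moreover have "m n = 2 * pi * real (Suc n) / real N" by (simp add: m_def k_def)
    ultimately have "complex_of_real (2 * (1 / m n * x) / ((1 / m n * x)^2 + 1)) / of_real (m n) =
        of_real (2 * x / (x^2 + (2 * pi * real (Suc n) / real N)^2))"
      by (metis of_real_divide)
    then have "g (1 / m n * x) / of_real (m n) = of_real (2 * x / (x^2 + (2 * pi * real (Suc n) / real N)^2))"
      by (simp only: g_def)
    moreover have "co n * g (1 / m n * x) = 1 / q * (a (Suc n) * (g (1 / m n * x) / of_real (m n)))"
      by (simp add: co_def)
    ultimately show ?thesis by simp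
  qed
  have "has_mellin R s ((\<Sum>n. co n * of_real (1 / m n) powr (-s)) * (of_real pi / cos (of_real pi * s / 2)))"
  proof (rule has_mellin_suminf)
    show "has_mellin g s (of_real pi / cos (of_real pi * s / 2))"
      unfolding g_def by (rule has_mellin_rational) (use s in auto)
    show "1 / m n > 0" for n using m[of n] by simp
    show "summable (\<lambda>n. norm (co n) * (1 / m n) powr (- Re s))"
    proof -
      have "norm (co n) * (1 / m n) powr (- Re s) = k powr (Re s - 1) / norm q * (norm (a (Suc n)) * real (Suc n) powr (- (1 - Re s)))" for n
      proof -
        have "(1 / m n) powr (- Re s) = m n powr Re s" using m[of n] by (simp add: powr_divide powr_minus)
        moreover have "m n powr Re s / m n = m n powr (Re s - 1)" using m[of n] by (simp add: powr_diff)
        moreover have "m n powr (Re s - 1) = k powr (Re s - 1) * real (Suc n) powr (Re s - 1)"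
          unfolding m_def by (rule powr_mult)
        moreover have "norm (co n) = norm (a (Suc n)) / (norm q * m n)"
          using m[of n] by (simp add: co_def norm_divide norm_mult)
        moreover have "norm (a (Suc n)) / (norm q * m n) * m n powr Re s = norm (a (Suc n)) / norm q * (m n powr Re s / m n)"
          by simp
        ultimately have "norm (co n) * (1 / m n) powr (- Re s) = norm (a (Suc n)) / norm q * (k powr (Re s - 1) * real (Suc n) powr (Re s - 1))"
          by (simp only:)
        then show ?thesis by (simp del: of_nat_Suc)
      qed
      then show ?thesis using summable_mult[OF summable_norm_L[of "1 - Re s"]] s by simp
    qed
    show "summable (\<lambda>n. norm (co n * g (1 / m n * x)))" if "x > 0" for x
      unfolding term_eq norm_mult[of "1 / q"] by (intro summable_mult summable_poisson that)
    show "(\<lambda>n. co n * g (1 / m n * x)) sums R x" if "x > 0" for x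
    proof -
      have "1 / q * (q * (E x + a 0 / 2) - a 0 / of_real x) = R x"
        using q by (simp add: R_def c_def d_def right_diff_distrib flip: q_def)
      then show ?thesis
        using sums_mult[OF partial_fractions[OF that], of "1 / q"] unfolding term_eq q_def by simp
    qed
  qed
  also have "(\<Sum>n. co n * of_real (1 / m n) powr (-s)) = of_real k powr (s - 1) / q * L (1 - s)"
  proof -
    have "co n * of_real (1 / m n) powr (-s) = of_real k powr (s - 1) / q * (a (Suc n) / of_nat (Suc n) powr (1 - s))" for n
    proof -
      have "complex_of_real (1 / m n) powr (-s) = of_real (m n) powr s"
        using m[of n] Ln_of_real[of "m n"] Ln_of_real[of "1 / m n"] by (simp add: powr_def ln_div)
      moreover have "complex_of_real (m n) powr s / of_real (m n) = of_real (m n) powr (s - 1)"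
        using m[of n] by (simp add: powr_diff)
      moreover have "complex_of_real (m n) powr (s - 1) = of_real k powr (s - 1) * of_nat (Suc n) powr (s - 1)"
        using k powr_times_real[of "of_real k" "of_nat (Suc n)" "s - 1"] by (simp add: m_def)
      moreover have "complex_of_nat (Suc n) powr (s - 1) = 1 / of_nat (Suc n) powr (1 - s)"
        by (simp add: powr_minus [symmetric] divide_inverse)
      moreover have "co n * of_real (m n) powr s = a (Suc n) / q * (of_real (m n) powr s / of_real (m n))"
        by (simp add: co_def)
      ultimately show ?thesis by (simp del: of_nat_Suc)
    qed
    moreover have "(\<lambda>n. of_real k powr (s - 1) / q * (a (Suc n) / of_nat (Suc n) powr (1 - s))) sums (of_real k powr (s - 1) / q * L (1 - s))"
      by (intro sums_mult L_sums) (use s in simp)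
    ultimately show ?thesis by (simp add: sums_iff del: of_nat_Suc)
  qed
  finally show ?thesis by (simp only: k_def q_def)
qed

definition lower_part :: "complex \<Rightarrow> complex" where
  "lower_part s = (LINT x:{0<..1}|lborel. of_real x powr (s - 1) * R x)"

definition upper_part :: "complex \<Rightarrow> complex" where
  "upper_part s = (LINT x:{1<..}|lborel. of_real x powr (s - 1) * E x)"

lemma set_integrable_lower:
  assumes "Re s > -1"
  shows "set_integrable lborel {0<..1} (\<lambda>x. of_real x powr (s - 1) * R x)"
proof (rule set_integrable_powr_bound)
  define t where "t = complex_of_real (min (Re s) (-1/2))"
  have t: "-1 < Re t" "Re t < 0" "Re t \<le> Re s" using assms by (auto simp: t_def)
  have "set_integrable lborel {0<..} (\<lambda>x. of_real x powr (t - 1) * R x)"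
    using has_mellin_R[OF t(1,2)] by (simp add: has_mellin_iff)
  then show "set_integrable lborel {0<..1} (\<lambda>x. of_real x powr (t - 1) * R x)"
    by (rule set_integrable_subset) auto
  show "x powr Re s \<le> x powr Re t" if "x \<in> {0<..1}" for x
    using that t by (intro powr_mono') auto
qed auto

lemma set_integrable_upper: "set_integrable lborel {1<..} (\<lambda>x. of_real x powr (s - 1) * E x)"
proof (rule set_integrable_powr_bound)
  define t where "t = complex_of_real (max (Re s) 2)"
  have t: "1 < Re t" "Re s \<le> Re t" by (auto simp: t_def)
  have "set_integrable lborel {0<..} (\<lambda>x. of_real x powr (t - 1) * E x)"
    using has_mellin_E[OF t(1)] by (simp add: has_mellin_iff)
  then show "set_integrable lborel {1<..} (\<lambda>x. of_real x powr (t - 1) * E x)"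
    by (rule set_integrable_subset) auto
  show "x powr Re s \<le> x powr Re t" if "x \<in> {1<..}" for x
    using that t by (intro powr_mono) auto
qed auto

lemma holomorphic_lower_part: "lower_part holomorphic_on {s. Re s > -1}"
  unfolding lower_part_def by (rule holomorphic_on_powr_integral) (auto simp: open_halfspace_Re_gt set_integrable_lower)

lemma holomorphic_upper_part: "upper_part holomorphic_on UNIV"
  unfolding upper_part_def by (rule holomorphic_on_powr_integral) (auto simp: set_integrable_upper)

definition Lambda :: "complex \<Rightarrow> complex" where
  "Lambda s = lower_part s + upper_part s + c / (s - 1) - d / s"

lemma Lambda_right:
  assumes s: "Re s > 1"
  shows "L s * Gamma s = Lambda s"
proof -
  have m: "has_mellin E s (L s * Gamma s)" by (rule has_mellin_E[OF s])
  have un: "{0<..} = {0<..1} \<union> {1::real<..}" and disj: "{0<..1} \<inter> {1::real<..} = {}" by auto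
  have r: "Re s > -1" "Re (s - 1) > 0" "Re s > 0" using s by auto
  have "\<forall>x\<in>{0<..1}. complex_of_real x powr (s - 1) * E x = of_real x powr (s - 1) * R x + c * of_real x powr (s - 1 - 1) + (- d) * of_real x powr (s - 1)"
    by (rule ballI) (simp add: R_def powr_diff algebra_simps add_divide_distrib power2_eq_square)
  note * = set_integral_linear_combination[OF set_integrable_lower[OF r(1)] integral_powr_Ioc(1)[OF r(2)] integral_powr_Ioc(1)[OF r(3)] this,
      unfolded integral_powr_Ioc(2)[OF r(2)] integral_powr_Ioc(2)[OF r(3)], folded lower_part_def]
  have "L s * Gamma s = (LINT x:{0<..}|lborel. of_real x powr (s - 1) * E x)"
    using m by (simp add: has_mellin_iff)
  also have "\<dots> = (lower_part s + c * (1 / (s - 1)) + (- d) * (1 / s)) + upper_part s"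
    unfolding un set_integral_Un[OF disj *(1) set_integrable_upper] *(2) upper_part_def ..
  finally show ?thesis by (simp add: Lambda_def)
qed

lemma Lambda_left:
  assumes s: "-1 < Re s" "Re s < 0"
  shows "Lambda s = of_real (2 * pi / real N) powr (s - 1) / of_real (sqrt (real N)) * L (1 - s) *
           (of_real pi / cos (of_real pi * s / 2))"
proof -
  note m = has_mellin_R[OF s]
  have un: "{0<..} = {0<..1} \<union> {1::real<..}" and disj: "{0<..1} \<inter> {1::real<..} = {}" by auto
  have r: "Re (s - 1) < 0" "Re s < 0" using s by auto
  have "\<forall>x\<in>{1<..}. complex_of_real x powr (s - 1) * R x = of_real x powr (s - 1) * E x + (- c) * of_real x powr (s - 1 - 1) + d * of_real x powr (s - 1)"
    by (rule ballI) (simp add: R_def powr_diff algebra_simps add_divide_distrib power2_eq_square)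
  note * = set_integral_linear_combination[OF set_integrable_upper integral_powr_Ioi(1)[OF r(1)] integral_powr_Ioi(1)[OF r(2)] this,
      unfolded integral_powr_Ioi(2)[OF r(1)] integral_powr_Ioi(2)[OF r(2)], folded upper_part_def]
  have "(LINT x:{0<..}|lborel. of_real x powr (s - 1) * R x) = lower_part s + (upper_part s + (- c) * (- (1 / (s - 1))) + d * (- (1 / s)))"
    unfolding un set_integral_Un[OF disj set_integrable_lower[OF s(1)] *(1)] *(2) lower_part_def ..
  also have "\<dots> = Lambda s" by (simp add: Lambda_def)
  finally show ?thesis using m by (simp add: has_mellin_iff)
qed

text \<open>
  \<open>Lambda s / Gamma s\<close>, with the pole of \<open>d / s\<close> at \<open>0\<close> cancelled against the zero of \<open>rGamma\<close>. The middle
  summand is identically \<open>0\<close> when \<open>a 0 = 0\<close>, so in that case there is no singularity at \<open>1\<close>.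
\<close>

definition H :: "complex \<Rightarrow> complex" where
  "H s = rGamma s * (lower_part s + upper_part s) + c * rGamma s / (s - 1) - d * rGamma (s + 1)"

definition WN :: "complex \<Rightarrow> complex" where
  "WN s = of_nat N powr (1/2 - s) * 2 * (2 * of_real pi) powr (s - 1) * Gamma (1 - s) * sin (of_real pi * s / 2)"

lemma H_eq:
  assumes "s \<noteq> 0"
  shows "H s = rGamma s * Lambda s"
proof -
  have "rGamma (s + 1) = rGamma s / s"
    using rGamma_plus1[of s] assms by (simp add: field_simps)
  then show ?thesis by (simp add: H_def Lambda_def algebra_simps)
qed

lemma H_right:
  assumes "Re s > 1"
  shows "H s = L s"
proof -
  have "s \<notin> \<int>\<^sub>\<le>\<^sub>0" using assms by (auto elim!: nonpos_Ints_cases)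
  then have "rGamma s * Gamma s = 1" by (simp add: rGamma_inverse_Gamma Gamma_eq_zero_iff)
  moreover have "s \<noteq> 0" using assms by auto
  ultimately show ?thesis
    using Lambda_right[OF assms] H_eq[of s] by (metis mult.commute mult.left_commute mult.right_neutral)
qed

lemma WN_eq:
  assumes s: "-1 < Re s" "Re s < 0"
  shows "rGamma s * (of_real (2 * pi / real N) powr (s - 1) / of_real (sqrt (real N)) *
           (of_real pi / cos (of_real pi * s / 2))) = WN s"
proof -
  have cos_nz: "cos (of_real pi * s / 2) \<noteq> 0"
    using s by (intro cos_half_pi_nonzero) auto
  have notin: "1 - s \<notin> \<int>\<^sub>\<le>\<^sub>0" using s by (auto elim!: nonpos_Ints_cases simp: complex_eq_iff)
  have G: "rGamma (1 - s) * Gamma (1 - s) = 1" using notin by (simp add: rGamma_inverse_Gamma Gamma_eq_zero_iff)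
  have "rGamma s * of_real pi = rGamma s * rGamma (1 - s) * of_real pi * Gamma (1 - s)"
    using G by (simp add: mult_ac)
  also have "\<dots> = sin (of_real pi * s) * Gamma (1 - s)"
    by (simp add: rGamma_reflection_complex)
  also have "sin (of_real pi * s) = 2 * sin (of_real pi * s / 2) * cos (of_real pi * s / 2)"
    using sin_double[of "of_real pi * s / 2"] by simp
  finally have r: "rGamma s * of_real pi / cos (of_real pi * s / 2) = 2 * sin (of_real pi * s / 2) * Gamma (1 - s)"
    using cos_nz by simp
  have p: "complex_of_real (2 * pi / real N) powr (s - 1) / of_real (sqrt (real N)) =
      of_nat N powr (1/2 - s) * (2 * of_real pi) powr (s - 1)"
  proof -
    have n: "real N > 0" using N by simp
    have e1: "complex_of_real (2 * pi / real N) powr (s - 1) = exp ((s - 1) * of_real (ln (2 * pi) - ln (real N)))"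
      using n by (simp add: powr_def Ln_of_real ln_div del: of_real_divide of_real_mult)
    have e2: "complex_of_real (sqrt (real N)) = exp (of_real (ln (real N) / 2))"
    proof -
      have "sqrt (real N) = exp (ln (real N) / 2)"
        using n by (simp add: powr_half_sqrt [symmetric] powr_def)
      then show ?thesis by (simp only: exp_of_real)
    qed
    have "of_nat N powr (1/2 - s) = exp ((1/2 - s) * of_real (ln (real N)))"
      using n Ln_of_real[OF n] by (simp add: powr_def)
    moreover have "(2 * complex_of_real pi) powr (s - 1) = exp ((s - 1) * of_real (ln (2 * pi)))"
      using Ln_of_real[of "2 * pi"] by (simp add: powr_def)
    ultimately show ?thesis
      unfolding e1 e2 by (simp only: exp_diff [symmetric] exp_add [symmetric])
        (rule arg_cong[of _ _ exp], simp add: algebra_simps)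
  qed
  have "rGamma s * (of_real (2 * pi / real N) powr (s - 1) / of_real (sqrt (real N)) *
           (of_real pi / cos (of_real pi * s / 2))) =
        (of_real (2 * pi / real N) powr (s - 1) / of_real (sqrt (real N))) * (rGamma s * of_real pi / cos (of_real pi * s / 2))"
    by simp
  also have "\<dots> = WN s" unfolding r p by (simp add: WN_def)
  finally show ?thesis .
qed

lemma H_left:
  assumes s: "-1 < Re s" "Re s < 0"
  shows "H s = WN s * L (1 - s)"
proof -
  have "s \<noteq> 0" using s by auto
  then have "H s = rGamma s * Lambda s" by (rule H_eq)
  then show ?thesis unfolding Lambda_left[OF s] WN_eq[OF s, symmetric] by simp
qed

lemma holomorphic_WN: "WN holomorphic_on (UNIV - \<nat>)"
proof -
  have "1 - s \<notin> \<int>\<^sub>\<le>\<^sub>0" if "s \<notin> \<nat>" for s :: complex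
  proof
    assume "1 - s \<in> \<int>\<^sub>\<le>\<^sub>0"
    then obtain n :: nat where "1 - s = - of_nat n" by (auto elim: nonpos_Ints_cases')
    then have "s = of_nat (Suc n)" by (simp add: algebra_simps)
    with that show False by (metis of_nat_in_Nats)
  qed
  then show ?thesis unfolding WN_def by (intro holomorphic_intros) auto
qed

lemma holomorphic_H:
  assumes P: "P = {1} \<or> P = {} \<and> a 0 = 0"
  shows "H holomorphic_on ({s. Re s > -1} - P)"
proof -
  have "(\<lambda>s. c * rGamma s / (s - 1)) holomorphic_on ({s. Re s > -1} - P)"
    using P
  proof
    assume "P = {1}"
    then show ?thesis by (auto intro!: holomorphic_intros)
  qed (simp add: c_def)
  moreover have "lower_part holomorphic_on ({s. Re s > -1} - P)" "upper_part holomorphic_on ({s. Re s > -1} - P)"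
    using holomorphic_lower_part holomorphic_upper_part by (auto intro: holomorphic_on_subset)
  ultimately show ?thesis
    unfolding H_def by (intro holomorphic_on_add holomorphic_on_diff holomorphic_on_mult holomorphic_rGamma) (auto intro!: holomorphic_intros)
qed

lemma holomorphic_L: "L holomorphic_on {s. Re s > 1}"
proof (rule holomorphic_transform)
  show "H holomorphic_on {s. Re s > 1}"
    by (rule holomorphic_on_subset[OF holomorphic_H[of "{1}"]]) auto
qed (simp add: H_right)

theorem continuation:
  assumes P: "P = {1} \<or> P = {} \<and> a 0 = 0"
  shows "\<exists>F. is_dirichlet_continuation a P F \<and> F meromorphic_on UNIV \<and>
             (\<forall>s. s \<notin> \<nat> \<longrightarrow> F s = WN s * F (1 - s))"
proof -
  define F where "F = (\<lambda>s. if s \<in> P then 0 else if Re s > -1 then H s else WN s * L (1 - s))"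
  have P1: "s \<in> P \<Longrightarrow> s = 1" for s using P by auto
  have finP: "finite P" using P by auto
  have right: "F s = L s" if "Re s > 1" for s
    using that P1[of s] by (auto simp: F_def H_right)
  have left: "F s = WN s * L (1 - s)" if "Re s < 0" for s
    using that P1[of s] by (auto simp: F_def H_left)
  have hol: "F holomorphic_on (UNIV - P)"
  proof -
    have "F holomorphic_on ({s. Re s > -1} - P)"
      by (rule holomorphic_transform[OF holomorphic_H[OF P]]) (simp add: F_def)
    moreover have "F holomorphic_on {s. Re s < 0}"
    proof (rule holomorphic_transform)
      have "(\<lambda>s. L (1 - s)) holomorphic_on {s. Re s < 0}"
        using holomorphic_on_compose_gen[OF _ holomorphic_L, of "\<lambda>s. 1 - s" "{s. Re s < 0}"]
        by (simp add: o_def holomorphic_intros image_subset_iff)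
      moreover have "WN holomorphic_on {s. Re s < 0}"
        by (rule holomorphic_on_subset[OF holomorphic_WN]) (auto elim!: Nats_cases)
      ultimately show "(\<lambda>s. WN s * L (1 - s)) holomorphic_on {s. Re s < 0}"
        by (intro holomorphic_intros)
    qed (simp add: left)
    moreover have "UNIV - P = ({s. Re s > -1} - P) \<union> {s. Re s < 0}"
      using P1 by force
    ultimately show ?thesis
      using finP by (simp only:) (intro holomorphic_on_Un open_Diff finite_imp_closed open_halfspace_Re_gt open_halfspace_Re_lt)
  qed
  have cont: "is_dirichlet_continuation a P F"
    unfolding is_dirichlet_continuation_def using hol right L_sums by (auto simp: F_def)
  have "F meromorphic_on {z}" for z
  proof (cases "z \<in> P")
    case False
    have "F analytic_on (UNIV - P)"
      using hol finP by (simp add: analytic_on_open open_Diff finite_imp_closed)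
    then show ?thesis
      using False by (intro analytic_on_imp_meromorphic_on) (auto intro: analytic_on_subset)
  next
    case True
    then have z: "z = 1" by (rule P1)
    have "lower_part analytic_on {s. Re s > -1}" "upper_part analytic_on UNIV"
      using holomorphic_lower_part holomorphic_upper_part by (simp_all add: analytic_on_open open_halfspace_Re_gt)
    then have an: "lower_part analytic_on {1}" "upper_part analytic_on {1}"
      using analytic_on_subset[of lower_part _ "{1}"] analytic_on_subset[of upper_part _ "{1}"] by auto
    have "rGamma analytic_on {1}" "(\<lambda>s. rGamma (s + 1)) analytic_on {1}"
      by (intro analytic_intros)+
    with an have "H meromorphic_on {1}"
      unfolding H_def by (intro meromorphic_intros) (auto intro: analytic_on_imp_meromorphic_on)
    moreover have "\<forall>\<^sub>F w in at 1. F w = H w"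
    proof -
      have "\<forall>\<^sub>F w in at 1. w \<in> {s. Re s > -1} - {1}"
        by (intro eventually_at_in_open open_halfspace_Re_gt) simp
      then show ?thesis by eventually_elim (use P1 in \<open>auto simp: F_def\<close>)
    qed
    ultimately show ?thesis
      using meromorphic_on_cong[of "{1}" F H "{1}"] by (auto simp: z)
  qed
  then have mero: "F meromorphic_on UNIV" by (subst meromorphic_on_meromorphic_at) blast
  have "F s = WN s * F (1 - s)" if "s \<notin> \<nat>" for s
  proof (rule analytic_continuation_open[where f = F and g = "\<lambda>s. WN s * F (1 - s)" and s = "{s. Re s < 0}" and s' = "UNIV - \<nat>"])
    have "-1 \<in> {s. Re s < 0}" by simp
    then show "{s. Re s < 0} \<noteq> {}" by blast
    have "countable (\<nat> :: complex set)" by (simp add: Nats_def)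
    then show "connected (UNIV - \<nat> :: complex set)"
      by (intro connected_open_diff_countable) auto
    show "{s. Re s < 0} \<subseteq> UNIV - \<nat>" by (auto elim!: Nats_cases)
    show "F holomorphic_on UNIV - \<nat>"
      by (rule holomorphic_on_subset[OF hol]) (use P1 in force)
    have "(\<lambda>s. F (1 - s)) holomorphic_on (UNIV - \<nat>)"
    proof -
      have "(\<lambda>s. 1 - s) ` (UNIV - \<nat>) \<subseteq> UNIV - P"
      proof (clarsimp)
        fix s :: complex assume "s \<notin> \<nat>" "1 - s \<in> P"
        then show False using P1[of "1 - s"] by simp
      qed
      from holomorphic_on_compose_gen[OF _ hol this]
      show ?thesis by (simp add: o_def holomorphic_intros)
    qed
    then show "(\<lambda>s. WN s * F (1 - s)) holomorphic_on UNIV - \<nat>"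
      by (intro holomorphic_on_mult holomorphic_WN)
    show "F z = WN z * F (1 - z)" if "z \<in> {s. Re s < 0}" for z
      using that left[of z] right[of "1 - z"] by simp
  qed (use that in \<open>auto simp: open_halfspace_Re_lt open_Diff\<close>)
  with cont mero show ?thesis by blast
qed

end

subsection \<open>The deformation\<close>

lemma gauss_sum_5:
  defines "w \<equiv> cis (- 2 * pi / 5)"
  shows "w ^ 5 = 1" and "w + w^4 - (w^2 + w^3) = of_real (sqrt 5)"
proof -
  have "w ^ 5 = cis (- (2 * pi))" unfolding w_def Complex.DeMoivre by simp
  then show w5: "w ^ 5 = 1" by (simp add: cis.ctr complex_eq_iff)
  have "w \<noteq> 1"
  proof
    assume "w = 1"
    then have "cos (2 * pi / 5) = 1" by (simp add: w_def complex_eq_iff)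
    moreover have "cos (2 * pi / 5) < cos 0"
      by (rule cos_monotone_0_pi) (use pi_gt_zero in auto)
    ultimately show False by simp
  qed
  have "(w - 1) * (1 + w + w^2 + w^3 + w^4) = w ^ 5 - 1"
    by (simp add: algebra_simps power_numeral_reduce)
  with w5 \<open>w \<noteq> 1\<close> have s0: "1 + w + w^2 + w^3 + w^4 = 0" by simp
  define u where "u = w + w^4"
  define v where "v = w^2 + w^3"
  have v: "v = - 1 - u" using s0 by (simp add: u_def v_def algebra_simps) (metis add.assoc add.commute add_eq_0_iff)
  have "u * v = w^3 + w^4 + w^5 * w + w^5 * w^2"
    by (simp add: u_def v_def algebra_simps power_numeral_reduce)
  also have "\<dots> = u + v" by (simp add: w5 u_def v_def)
  finally have uv: "u * v = -1" by (simp add: v)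
  have "cnj w = w^4"
  proof -
    have "w * w^4 = 1" using w5 by (simp add: power_numeral_reduce)
    moreover have "w * cnj w = 1" by (simp add: w_def cis_cnj cis_mult)
    moreover have "w \<noteq> 0" by (simp add: w_def)
    ultimately show ?thesis by (metis mult_cancel_left)
  qed
  then have u: "u = of_real (2 * cos (2 * pi / 5))"
    using complex_add_cnj[of w] by (simp add: u_def w_def)
  define t where "t = 2 * cos (2 * pi / 5)"
  have "t > 0" unfolding t_def by (intro mult_pos_pos cos_gt_zero) (use pi_gt_zero in auto)
  have "complex_of_real ((2 * t + 1)^2) = (u - v)^2"
    by (simp add: v u t_def algebra_simps)
  also have "(u - v)^2 = (u + v)^2 - 4 * (u * v)" by (simp add: power2_eq_square algebra_simps)
  also have "\<dots> = of_real 5" by (simp add: uv) (simp add: v)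
  finally have "(2 * t + 1)^2 = 5" by (simp only: of_real_eq_iff)
  then have "sqrt 5 = 2 * t + 1" using \<open>t > 0\<close> by (metis real_sqrt_unique add_nonneg_nonneg less_imp_le mult_nonneg_nonneg zero_le_one zero_le_numeral)
  moreover have "u - v = of_real (2 * t + 1)" by (simp add: v u t_def)
  ultimately show "w + w^4 - (w^2 + w^3) = of_real (sqrt 5)" by (simp add: u_def v_def)
qed

lemma chi5_dual:
  "(\<Sum>r<5. chi5 r * cis (- 2 * pi * real r * real k / real 5)) = of_real (sqrt (real 5)) * chi5 k"
proof -
  define w where "w = cis (- 2 * pi / 5)"
  define g where "g = complex_of_real (sqrt 5)"
  have w5: "w ^ 5 = 1" and g: "w + w^4 - (w^2 + w^3) = g"
    using gauss_sum_5 by (simp_all only: w_def g_def)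
  have wm: "w ^ n = w ^ (n mod 5)" for n
  proof -
    have "w ^ n = w ^ (5 * (n div 5) + n mod 5)" by simp
    then show ?thesis unfolding power_add power_mult w5 by simp
  qed
  have c: "cis (- 2 * pi * real r * real k / real 5) = w ^ (r * k mod 5)" for r
  proof -
    have "w ^ (r * k) = cis (- 2 * pi * real r * real k / real 5)"
      unfolding w_def Complex.DeMoivre by (rule arg_cong[of _ _ cis]) simp
    then show ?thesis using wm by metis
  qed
  have "(\<Sum>r<5. chi5 r * cis (- 2 * pi * real r * real k / real 5)) =
      w ^ (k mod 5) - w ^ (2 * k mod 5) - w ^ (3 * k mod 5) + w ^ (4 * k mod 5)"
  proof -
    have "{..<5} = {0, 1, 2, 3, 4::nat}" by auto
    then show ?thesis unfolding c by (simp add: chi5_def)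
  qed
  also have "\<dots> = g * chi5 k"
  proof -
    have m: "2 * k mod 5 = 2 * (k mod 5) mod 5" "3 * k mod 5 = 3 * (k mod 5) mod 5" "4 * k mod 5 = 4 * (k mod 5) mod 5"
      by (simp_all add: mod_mult_right_eq)
    have "k mod 5 = 0 \<or> k mod 5 = 1 \<or> k mod 5 = 2 \<or> k mod 5 = 3 \<or> k mod 5 = 4" by presburger
    then show ?thesis
      unfolding m using g by (elim disjE) (simp_all add: chi5_def algebra_simps power2_eq_square flip: g)
  qed
  finally show ?thesis by (simp add: g_def)
qed

interpretation zeta: self_dual 1 "\<lambda>_. 1"
  by standard auto

interpretation chi: self_dual 5 chi5
proof
  show "chi5 (n + 5) = chi5 n" for n by (simp add: chi5_def)
  show "chi5 (5 - r) = chi5 r" if "r \<le> 5" for r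
  proof -
    have "r = 0 \<or> r = 1 \<or> r = 2 \<or> r = 3 \<or> r = 4 \<or> r = 5" using that by presburger
    then show ?thesis by (elim disjE) (simp_all add: chi5_def)
  qed
qed (use chi5_dual in simp_all)

definition W1 :: "complex \<Rightarrow> complex" where
  "W1 s = 2 * (2 * of_real pi) powr (s - 1) * Gamma (1 - s) * sin (of_real pi * s / 2)"

lemma W_eq: "W s = 5 powr (1/2 - s) * W1 s"
  by (simp add: W_def W1_def)

lemma riemann_zeta_properties:
  shows "is_dirichlet_continuation (\<lambda>_. 1) {1} riemann_zeta"
    and "riemann_zeta meromorphic_on UNIV"
    and "s \<notin> \<nat> \<Longrightarrow> riemann_zeta s = W1 s * riemann_zeta (1 - s)"
proof -
  obtain F where F: "is_dirichlet_continuation (\<lambda>_. 1) {1} F" "F meromorphic_on UNIV"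
    "\<And>s. s \<notin> \<nat> \<Longrightarrow> F s = zeta.WN s * F (1 - s)"
    using zeta.continuation[of "{1}"] by blast
  have "riemann_zeta = F"
    unfolding riemann_zeta_def by (rule dirichlet_continuation_eqI) (use F in auto)
  moreover have "zeta.WN s = W1 s" unfolding zeta.WN_def W1_def by simp
  ultimately show "is_dirichlet_continuation (\<lambda>_. 1) {1} riemann_zeta" "riemann_zeta meromorphic_on UNIV"
    "s \<notin> \<nat> \<Longrightarrow> riemann_zeta s = W1 s * riemann_zeta (1 - s)"
    using F(1,2) F(3)[of s] by simp_all
qed

lemma f1_properties:
  shows "is_dirichlet_continuation chi5 {} f1"
    and "f1 meromorphic_on UNIV"
    and "s \<notin> \<nat> \<Longrightarrow> f1 s = W s * f1 (1 - s)"
proof -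
  have "chi5 0 = 0" by (simp add: chi5_def)
  then obtain F where F: "is_dirichlet_continuation chi5 {} F" "F meromorphic_on UNIV"
    "\<And>s. s \<notin> \<nat> \<Longrightarrow> F s = chi.WN s * F (1 - s)"
    using chi.continuation[of "{}"] by blast
  have "f1 = F"
    unfolding f1_def by (rule dirichlet_continuation_eqI) (use F in auto)
  moreover have "chi.WN s = W s" unfolding chi.WN_def W_def by simp
  ultimately show "is_dirichlet_continuation chi5 {} f1" "f1 meromorphic_on UNIV"
    "s \<notin> \<nat> \<Longrightarrow> f1 s = W s * f1 (1 - s)"
    using F(1,2) F(3)[of s] by simp_all
qed

lemma dirichlet_continuation_cnj:
  assumes F: "is_dirichlet_continuation a P F" and P: "finite P" "P \<subseteq> \<real>" "\<And>s. s \<in> P \<Longrightarrow> Re s \<le> 1"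
    and a: "\<And>n. cnj (a n) = a n"
  shows "F (cnj s) = cnj (F s)"
proof -
  define G where "G = cnj \<circ> F \<circ> cnj"
  have cP: "cnj s \<in> P \<longleftrightarrow> s \<in> P" for s
    using P(2) by (metis Reals_cnj_iff complex_cnj_cnj subsetD)
  have "is_dirichlet_continuation a P G"
    unfolding is_dirichlet_continuation_def
  proof (intro conjI allI impI ballI)
    have "cnj ` (UNIV - P) = UNIV - P"
    proof (intro equalityI subsetI)
      fix s assume "s \<in> UNIV - P"
      then show "s \<in> cnj ` (UNIV - P)" by (intro image_eqI[of _ _ "cnj s"]) (auto simp: cP)
    qed (auto simp: cP)
    then show "G holomorphic_on UNIV - P"
      unfolding G_def using F P(1)
      by (intro holomorphic_on_compose_cnj_cnj) (auto simp: is_dirichlet_continuation_def open_Diff finite_imp_closed)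
    fix s
    show "G s = 0" if "s \<in> P"
      using F that cP[of s] by (simp add: G_def is_dirichlet_continuation_def)
    assume "Re s > 1"
    then have "(\<lambda>n. a (Suc n) / of_nat (Suc n) powr cnj s) sums F (cnj s)"
      using F by (simp add: is_dirichlet_continuation_def)
    then have "(\<lambda>n. cnj (a (Suc n) / of_nat (Suc n) powr cnj s)) sums cnj (F (cnj s))"
      by (simp only: sums_cnj)
    moreover have "cnj (a (Suc n) / of_nat (Suc n) powr cnj s) = a (Suc n) / of_nat (Suc n) powr s" for n
      using cnj_powr[of "of_nat (Suc n)" "cnj s"] a by (simp del: of_nat_Suc)
    ultimately show "(\<lambda>n. a (Suc n) / of_nat (Suc n) powr s) sums G s"
      by (simp add: G_def)
  qed
  then have "G = F" using is_dirichlet_continuation_unique P F by blast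
  then have "F (cnj s) = G (cnj s)" by simp
  then show ?thesis by (simp add: G_def)
qed

lemma phi_cnj: "phi \<tau> (cnj s) = cnj (phi \<tau> s)"
proof -
  have "riemann_zeta (cnj s) = cnj (riemann_zeta s)"
    by (rule dirichlet_continuation_cnj[OF riemann_zeta_properties(1)]) auto
  moreover have "f1 (cnj s) = cnj (f1 s)"
    by (rule dirichlet_continuation_cnj[OF f1_properties(1)]) (auto simp: chi5_def)
  moreover have "5 powr cnj s = cnj (5 powr s)" using cnj_powr[of 5 s] by simp
  ultimately show ?thesis by (simp add: phi_def f0_def)
qed

lemma f0_functional_equation:
  assumes "s \<notin> \<nat>"
  shows "f0 s = W s * f0 (1 - s)"
proof -
  have sq: "complex_of_real (sqrt 5) = 5 powr (1/2)"
    using powr_of_real[of 5 "1/2"] by (simp add: powr_half_sqrt)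
  have "5 powr (1/2 - s) * (1 + of_real (sqrt 5) / 5 powr (1 - s)) = 1 + of_real (sqrt 5) / 5 powr s"
  proof -
    define p where "p = (5 :: complex) powr s"
    define q where "q = (5 :: complex) powr (1/2)"
    have pq: "p \<noteq> 0" "q * q = 5" by (simp_all add: p_def q_def flip: powr_add)
    have "q / p * (1 + q / (5 / p)) = q / p + q * q / 5" using pq(1) by (simp add: field_simps)
    then show ?thesis
      using pq(2) unfolding sq by (simp add: powr_diff flip: p_def q_def)
  qed
  then have "f0 s = 5 powr (1/2 - s) * (1 + of_real (sqrt 5) / 5 powr (1 - s)) * (W1 s * riemann_zeta (1 - s))"
    by (simp only: f0_def riemann_zeta_properties(3)[OF assms])
  then show ?thesis by (simp only: f0_def W_eq mult_ac)
qed

lemma meromorphic_f0: "f0 meromorphic_on UNIV"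
proof -
  have "(\<lambda>s. 1 + of_real (sqrt 5) / 5 powr s) holomorphic_on UNIV"
    by (intro holomorphic_intros) auto
  then have "(\<lambda>s. 1 + of_real (sqrt 5) / 5 powr s) meromorphic_on UNIV"
    by (intro analytic_on_imp_meromorphic_on) (simp add: analytic_on_open)
  then show ?thesis
    unfolding f0_def by (rule meromorphic_on_mult[OF _ riemann_zeta_properties(2)])
qed

lemma meromorphic_W: "W meromorphic_on UNIV"
proof -
  have "(\<lambda>s. 5 powr (1/2 - s) * 2 * (2 * of_real pi) powr (s - 1) * sin (of_real pi * s / 2)) holomorphic_on (UNIV :: complex set)"
    "(\<lambda>s. rGamma (1 - s)) holomorphic_on (UNIV :: complex set)"
    by (intro holomorphic_intros; simp)+
  then have "(\<lambda>s. 5 powr (1/2 - s) * 2 * (2 * of_real pi) powr (s - 1) * sin (of_real pi * s / 2)) meromorphic_on (UNIV :: complex set)"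
    "(\<lambda>s. rGamma (1 - s)) meromorphic_on (UNIV :: complex set)"
    by (intro analytic_on_imp_meromorphic_on; simp add: analytic_on_open)+
  then have "(\<lambda>s. (5 powr (1/2 - s) * 2 * (2 * of_real pi) powr (s - 1) * sin (of_real pi * s / 2)) * inverse (rGamma (1 - s))) meromorphic_on (UNIV :: complex set)"
    by (intro meromorphic_on_mult[OF _ meromorphic_on_inverse])
  also have "(\<lambda>s. (5 powr (1/2 - s) * 2 * (2 * of_real pi) powr (s - 1) * sin (of_real pi * s / 2)) * inverse (rGamma (1 - s))) = W"
    by (auto simp: W_def rGamma_inverse_Gamma)
  finally show ?thesis .
qed

lemma uniform_limit_phi:
  assumes K: "compact K" "K \<subseteq> UNIV - {1}"
  shows "uniform_limit K phi (phi \<tau>') (at \<tau>' within T)"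
proof -
  have h0: "f0 holomorphic_on UNIV - {1}"
    unfolding f0_def using riemann_zeta_properties(1)
    by (intro holomorphic_intros) (auto simp: is_dirichlet_continuation_def)
  have h1: "f1 holomorphic_on UNIV - {1}"
    using f1_properties(1) by (auto simp: is_dirichlet_continuation_def intro: holomorphic_on_subset)
  have "continuous_on K (\<lambda>s. f1 s - f0 s)"
    by (rule continuous_on_subset[OF holomorphic_on_imp_continuous_on[OF holomorphic_on_diff[OF h1 h0]] K(2)])
  then have "bounded ((\<lambda>s. f1 s - f0 s) ` K)"
    by (intro compact_imp_bounded compact_continuous_image K)
  then obtain B where B: "B > 0" "\<And>s. s \<in> K \<Longrightarrow> norm (f1 s - f0 s) \<le> B"
    unfolding bounded_pos by auto
  show ?thesis
  proof (rule uniform_limitI)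
    fix e :: real assume e: "e > 0"
    have "\<forall>\<^sub>F \<tau> in at \<tau>' within T. dist \<tau> \<tau>' < e / B"
      using e B(1) by (intro tendstoD[OF tendsto_ident_at]) simp
    then show "\<forall>\<^sub>F \<tau> in at \<tau>' within T. \<forall>s\<in>K. dist (phi \<tau> s) (phi \<tau>' s) < e"
    proof eventually_elim
      case (elim \<tau>)
      show ?case
      proof
        fix s assume s: "s \<in> K"
        have "phi \<tau> s - phi \<tau>' s = of_real (\<tau> - \<tau>') * (f1 s - f0 s)"
          by (simp add: phi_def algebra_simps)
        then have "dist (phi \<tau> s) (phi \<tau>' s) = \<bar>\<tau> - \<tau>'\<bar> * norm (f1 s - f0 s)"
          by (simp only: dist_norm norm_mult norm_of_real)
        also have "\<dots> \<le> \<bar>\<tau> - \<tau>'\<bar> * B" using B(2)[OF s] by (intro mult_left_mono) auto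
        also have "\<dots> < e" using elim B(1) by (simp add: dist_real_def pos_less_divide_eq)
        finally show "dist (phi \<tau> s) (phi \<tau>' s) < e" .
      qed
    qed
  qed
qed

theorem theorem1:
  shows "(\<forall>\<tau>\<in>{0..1}.
            phi \<tau> meromorphic_on UNIV \<and>
            W meromorphic_on UNIV \<and>
            (\<lambda>s. cnj (phi \<tau> (1 - cnj s))) meromorphic_on UNIV \<and>
            (\<forall>s. s \<notin> \<nat> \<longrightarrow> phi \<tau> s = W s * cnj (phi \<tau> (1 - cnj s)))) \<and>
         phi 0 = f0 \<and> phi 1 = f1 \<and>
         (\<forall>K. compact K \<and> K \<subseteq> UNIV - {1} \<longrightarrow>
            (\<forall>\<tau>'\<in>{0..1}. uniform_limit K phi (phi \<tau>') (at \<tau>' within {0..1})))"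
proof -
  have refl: "cnj (phi \<tau> (1 - cnj s)) = phi \<tau> (1 - s)" for \<tau> s
    using phi_cnj[of \<tau> "1 - cnj s"] by simp
  have mero: "phi \<tau> meromorphic_on UNIV" for \<tau>
    unfolding phi_def by (intro meromorphic_intros meromorphic_f0 f1_properties)
  have "(\<lambda>s. 1 - s) analytic_on (UNIV :: complex set)" by (intro analytic_intros)
  then have mero': "(\<lambda>s. phi \<tau> (1 - s)) meromorphic_on UNIV" for \<tau>
    by (intro meromorphic_on_compose[OF mero]) auto
  have "phi \<tau> s = W s * phi \<tau> (1 - s)" if "s \<notin> \<nat>" for \<tau> s
    using f0_functional_equation[OF that] f1_properties(3)[OF that]
    by (simp add: phi_def distrib_left mult.left_commute)
  moreover have "phi 0 = f0" "phi 1 = f1" by (simp_all add: phi_def fun_eq_iff)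
  ultimately show ?thesis
    using mero mero' meromorphic_W uniform_limit_phi by (simp add: refl)
qed

end
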